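(* Let $E$ be an effect algebra with RDP and let $(H,u)$ be a nontrivial Abelian unital po-group with RDP. Then $E$ is strong $(H,u)$-perfect if and only if there exists an Abelian directed po-group $G$ such that $E\cong\Gamma(H\overrightarrow{\times}G,(u,0))$. If this is the case, then $G$ is unique (up to isomorphism of po-groups) and it satisfies RDP.
   Context: An effect algebra is a partial algebra $(E;+,0,1)$ with a partial binary operation $+$ such that for all $a,b,c\in E$: (i) $a+b$ is defined iff $b+a$ is, and then $a+b=b+a$; (ii) $a+b$ and $(a+b)+c$ are defined iff $b+c$ and $a+(b+c)$ are, and then $(a+b)+c=a+(b+c)$; (iii) there is a unique $a^-\in E$ with $a+a^-=1$; (iv) if $a+1$ is defined then $a=0$. The order is $a\le b$ iff $a+c=b$ for some $c\in E$ (then $c=:b-a$). A homomorphism $h:E\to F$ satisfies $h(1)=1$ and, whenever $a+b$ is defined, $h(a)+h(b)$ is defined and equals $h(a+b)$; an isomorphism ($\cong$) is a bijection that is a homomorphism together with its inverse. A po-group is a group $(G;+,0)$ with a partial order such that $g\le h$ implies $k+g+f\le k+h+f$; $G^+=\{g:g\ge 0\}$. It is directed if any two elements have a common upper bound (equivalently a common lower bound). A strong unit is $u\in G^+$ such that each $g\in G$ satisfies $g\le nu$ for some integer $n\ge0$; $(G,u)$ is then a unital po-group. For an Abelian po-group and $u\in G^+$, $\Gamma(G,u)=\{g:0\le g\le u\}$ is an effect algebra with $a+b$ defined iff $a\le u-b$, being then the group sum, and with top $u$. RDP (Riesz Decomposition Property) for an Abelian po-group $G$ (resp. an effect algebra $E$):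 whenever $a_1+a_2=b_1+b_2$ with all elements in $G^+$ (resp. $E$), there are $c_{11},c_{12},c_{21},c_{22}$ in $G^+$ (resp. $E$) with $a_1=c_{11}+c_{12}$, $a_2=c_{21}+c_{22}$, $b_1=c_{11}+c_{21}$, $b_2=c_{12}+c_{22}$. The lexicographic product $H\overrightarrow{\times}G$ is the group $H\times G$ with the order $(h_1,g_1)\le(h_2,g_2)$ iff $h_1<h_2$, or $h_1=h_2$ and $g_1\le g_2$. Let $[0,u]_H=\{h\in H:0\le h\le u\}$. An $(H,u)$-decomposition of $E$ is a family $(E_t:t\in[0,u]_H)$ of nonempty pairwise disjoint subsets with union $E$ such that (a) $E_t^-:=\{x^-:x\in E_t\}=E_{u-t}$ for all $t$; (b) if $x\in E_s$, $y\in E_t$ and $x+y$ exists, then $s+t\le u$ and $x+y\in E_{s+t}$. It is ordered if $s<t$ implies $x\le y$ for all $x\in E_s,y\in E_t$; it is directed if each $E_t$ is both upwards and downwards directed as a poset. A strong $(H,u)$-decomposition is an ordered and directed $(H,u)$-decomposition for which there is a family $(c_t:t\in[0,u]_H)$ in $E$ with (i) $c_t\in E_t$; (ii) $c_v+c_t=c_{v+t}$ whenever $v,t\in[0,u]_H$, $v+t\le u$; (iii) $c_u=1$. An effect algebra $E$ with RDP is strong $(H,u)$-perfect if it has a strong $(H,u)$-decomposition. The zero po-group is allowed as $G$.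
   Formalization: Uniqueness of G is stated for a given strong (H,u)-decomposition of E (isomorphism matching E_t with first coordinate t); uniqueness from E alone fails, e.g. H = Z lex Z[x], u = (1,0), where G = 0 and G = Z give isomorphic effect algebras. *)

theory Defs
  imports "HOL-Algebra.Group" "HOL-Library.Disjoint_Sets"
begin

section \<open>Partially ordered groups\<close>

text \<open>
  Groups are those of HOL-Algebra, so the group operation is written multiplicatively:
  \<open>x \<otimes> y\<close>, \<open>\<one>\<close>, \<open>inv x\<close>, \<open>x [^] n\<close> stand for the \<open>x + y\<close>, \<open>0\<close>, \<open>-x\<close>, \<open>n x\<close> of the
  additive notation.
\<close>

record 'a po_monoid = "'a monoid" +
  po_le :: "'a \<Rightarrow> 'a \<Rightarrow> bool" (infixl \<open>\<preceq>\<index>\<close> 50)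

locale po_group = group G for G (structure) +
  assumes po_refl: "x \<in> carrier G \<Longrightarrow> x \<preceq> x"
    and po_antisym: "\<lbrakk>x \<in> carrier G; y \<in> carrier G; x \<preceq> y; y \<preceq> x\<rbrakk> \<Longrightarrow> x = y"
    and po_trans: "\<lbrakk>x \<in> carrier G; y \<in> carrier G; z \<in> carrier G; x \<preceq> y; y \<preceq> z\<rbrakk> \<Longrightarrow> x \<preceq> z"
    and po_translate: "\<lbrakk>g \<in> carrier G; h \<in> carrier G; k \<in> carrier G; f \<in> carrier G; g \<preceq> h\<rbrakk>
      \<Longrightarrow> k \<otimes> g \<otimes> f \<preceq> k \<otimes> h \<otimes> f"

locale abelian_po_group = po_group G + comm_group G for G (structure)

definition po_pos :: "('a, 'm) po_monoid_scheme \<Rightarrow> 'a set" where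
  "po_pos G = {g \<in> carrier G. \<one>\<^bsub>G\<^esub> \<preceq>\<^bsub>G\<^esub> g}"

definition po_less :: "('a, 'm) po_monoid_scheme \<Rightarrow> 'a \<Rightarrow> 'a \<Rightarrow> bool" where
  "po_less G g h \<longleftrightarrow> g \<preceq>\<^bsub>G\<^esub> h \<and> g \<noteq> h"

definition po_directed :: "('a, 'm) po_monoid_scheme \<Rightarrow> bool" where
  "po_directed G \<longleftrightarrow>
    (\<forall>g\<in>carrier G. \<forall>h\<in>carrier G. \<exists>k\<in>carrier G. g \<preceq>\<^bsub>G\<^esub> k \<and> h \<preceq>\<^bsub>G\<^esub> k)"

definition strong_unit :: "('a, 'm) po_monoid_scheme \<Rightarrow> 'a \<Rightarrow> bool" where
  "strong_unit G u \<longleftrightarrow>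
    u \<in> po_pos G \<and> (\<forall>g\<in>carrier G. \<exists>n::nat. g \<preceq>\<^bsub>G\<^esub> u [^]\<^bsub>G\<^esub> n)"

definition po_RDP :: "('a, 'm) po_monoid_scheme \<Rightarrow> bool" where
  "po_RDP G \<longleftrightarrow>
    (\<forall>a1\<in>po_pos G. \<forall>a2\<in>po_pos G. \<forall>b1\<in>po_pos G. \<forall>b2\<in>po_pos G.
      a1 \<otimes>\<^bsub>G\<^esub> a2 = b1 \<otimes>\<^bsub>G\<^esub> b2 \<longrightarrow>
      (\<exists>c11\<in>po_pos G. \<exists>c12\<in>po_pos G. \<exists>c21\<in>po_pos G. \<exists>c22\<in>po_pos G.
        a1 = c11 \<otimes>\<^bsub>G\<^esub> c12 \<and> a2 = c21 \<otimes>\<^bsub>G\<^esub> c22 \<and>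
        b1 = c11 \<otimes>\<^bsub>G\<^esub> c21 \<and> b2 = c12 \<otimes>\<^bsub>G\<^esub> c22))"

definition po_isomorphic :: "('a, 'm) po_monoid_scheme \<Rightarrow> ('b, 'n) po_monoid_scheme \<Rightarrow> bool" where
  "po_isomorphic G K \<longleftrightarrow>
    (\<exists>f\<in>iso G K. \<forall>x\<in>carrier G. \<forall>y\<in>carrier G. x \<preceq>\<^bsub>G\<^esub> y \<longleftrightarrow> f x \<preceq>\<^bsub>K\<^esub> f y)"

definition lex_prod ::
    "('h, 'm) po_monoid_scheme \<Rightarrow> ('g, 'n) po_monoid_scheme \<Rightarrow> ('h \<times> 'g) po_monoid" where
  "lex_prod H G =
    \<lparr>carrier = carrier (H \<times>\<times> G), mult = mult (H \<times>\<times> G), one = one (H \<times>\<times> G),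
     po_le = (\<lambda>(h1, g1) (h2, g2). po_less H h1 h2 \<or> h1 = h2 \<and> g1 \<preceq>\<^bsub>G\<^esub> g2)\<rparr>"

definition po_interval :: "('a, 'm) po_monoid_scheme \<Rightarrow> 'a \<Rightarrow> 'a set" where
  "po_interval G u = {g \<in> carrier G. \<one>\<^bsub>G\<^esub> \<preceq>\<^bsub>G\<^esub> g \<and> g \<preceq>\<^bsub>G\<^esub> u}"


section \<open>Effect algebras\<close>

text \<open>The partial sum \<open>a + b\<close> is \<open>None\<close> where it is undefined.\<close>

record 'a effect_alg = "'a partial_object" +
  ea_plus :: "'a \<Rightarrow> 'a \<Rightarrow> 'a option"
  ea_zero :: 'a
  ea_one :: 'a

text \<open>
  Equality of options is Kleene equality: one side is defined iff the other one is, and then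
  their values agree. In \<open>ea_assoc\<close>, \<open>Option.bind\<close> makes the left-hand side defined iff
  both \<open>a + b\<close> and \<open>(a + b) + c\<close> are.
\<close>

locale effect_algebra =
  fixes E :: "('a, 'm) effect_alg_scheme"
  assumes ea_zero_closed: "ea_zero E \<in> carrier E"
    and ea_one_closed: "ea_one E \<in> carrier E"
    and ea_plus_closed: "\<lbrakk>a \<in> carrier E; b \<in> carrier E; ea_plus E a b = Some c\<rbrakk> \<Longrightarrow> c \<in> carrier E"
    and ea_comm: "\<lbrakk>a \<in> carrier E; b \<in> carrier E\<rbrakk> \<Longrightarrow> ea_plus E a b = ea_plus E b a"
    and ea_assoc: "\<lbrakk>a \<in> carrier E; b \<in> carrier E; c \<in> carrier E\<rbrakk> \<Longrightarrow>
      Option.bind (ea_plus E a b) (\<lambda>x. ea_plus E x c) =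
      Option.bind (ea_plus E b c) (\<lambda>y. ea_plus E a y)"
    and ea_compl_unique: "a \<in> carrier E \<Longrightarrow> \<exists>!b. b \<in> carrier E \<and> ea_plus E a b = Some (ea_one E)"
    and ea_one_max: "\<lbrakk>a \<in> carrier E; ea_plus E a (ea_one E) \<noteq> None\<rbrakk> \<Longrightarrow> a = ea_zero E"

definition ea_compl :: "('a, 'm) effect_alg_scheme \<Rightarrow> 'a \<Rightarrow> 'a" where
  "ea_compl E a = (THE b. b \<in> carrier E \<and> ea_plus E a b = Some (ea_one E))"

definition ea_le :: "('a, 'm) effect_alg_scheme \<Rightarrow> 'a \<Rightarrow> 'a \<Rightarrow> bool" where
  "ea_le E a b \<longleftrightarrow> (\<exists>c\<in>carrier E. ea_plus E a c = Some b)"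

definition ea_RDP :: "('a, 'm) effect_alg_scheme \<Rightarrow> bool" where
  "ea_RDP E \<longleftrightarrow>
    (\<forall>a1\<in>carrier E. \<forall>a2\<in>carrier E. \<forall>b1\<in>carrier E. \<forall>b2\<in>carrier E. \<forall>s.
      ea_plus E a1 a2 = Some s \<and> ea_plus E b1 b2 = Some s \<longrightarrow>
      (\<exists>c11\<in>carrier E. \<exists>c12\<in>carrier E. \<exists>c21\<in>carrier E. \<exists>c22\<in>carrier E.
        ea_plus E c11 c12 = Some a1 \<and> ea_plus E c21 c22 = Some a2 \<and>
        ea_plus E c11 c21 = Some b1 \<and> ea_plus E c12 c22 = Some b2))"

definition ea_hom ::
    "('a, 'm) effect_alg_scheme \<Rightarrow> ('b, 'n) effect_alg_scheme \<Rightarrow> ('a \<Rightarrow> 'b) set" where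
  "ea_hom E F = {h. h \<in> carrier E \<rightarrow> carrier F \<and> h (ea_one E) = ea_one F \<and>
    (\<forall>a\<in>carrier E. \<forall>b\<in>carrier E. \<forall>c.
      ea_plus E a b = Some c \<longrightarrow> ea_plus F (h a) (h b) = Some (h c))}"

definition ea_iso ::
    "('a, 'm) effect_alg_scheme \<Rightarrow> ('b, 'n) effect_alg_scheme \<Rightarrow> ('a \<Rightarrow> 'b) set" where
  "ea_iso E F = {h. bij_betw h (carrier E) (carrier F) \<and> h \<in> ea_hom E F \<and>
    inv_into (carrier E) h \<in> ea_hom F E}"

definition ea_isomorphic ::
    "('a, 'm) effect_alg_scheme \<Rightarrow> ('b, 'n) effect_alg_scheme \<Rightarrow> bool" where
  "ea_isomorphic E F \<longleftrightarrow> ea_iso E F \<noteq> {}"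

definition Gamma :: "('a, 'm) po_monoid_scheme \<Rightarrow> 'a \<Rightarrow> 'a effect_alg" where
  "Gamma G u =
    \<lparr>carrier = po_interval G u,
     ea_plus = (\<lambda>a b. if a \<preceq>\<^bsub>G\<^esub> u \<otimes>\<^bsub>G\<^esub> inv\<^bsub>G\<^esub> b then Some (a \<otimes>\<^bsub>G\<^esub> b) else None),
     ea_zero = \<one>\<^bsub>G\<^esub>,
     ea_one = u\<rparr>"


section \<open>\<open>(H, u)\<close>-decompositions\<close>

definition decomposition ::
    "('h, 'm) po_monoid_scheme \<Rightarrow> 'h \<Rightarrow> ('a, 'n) effect_alg_scheme \<Rightarrow> ('h \<Rightarrow> 'a set) \<Rightarrow> bool" where
  "decomposition H u E D \<longleftrightarrow>
    (\<forall>t\<in>po_interval H u. D t \<noteq> {}) \<and>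
    disjoint_family_on D (po_interval H u) \<and>
    (\<Union>t\<in>po_interval H u. D t) = carrier E \<and>
    (\<forall>t\<in>po_interval H u. ea_compl E ` D t = D (u \<otimes>\<^bsub>H\<^esub> inv\<^bsub>H\<^esub> t)) \<and>
    (\<forall>s\<in>po_interval H u. \<forall>t\<in>po_interval H u. \<forall>x\<in>D s. \<forall>y\<in>D t. \<forall>z.
      ea_plus E x y = Some z \<longrightarrow> s \<otimes>\<^bsub>H\<^esub> t \<preceq>\<^bsub>H\<^esub> u \<and> z \<in> D (s \<otimes>\<^bsub>H\<^esub> t))"

definition ordered_decomposition ::
    "('h, 'm) po_monoid_scheme \<Rightarrow> 'h \<Rightarrow> ('a, 'n) effect_alg_scheme \<Rightarrow> ('h \<Rightarrow> 'a set) \<Rightarrow> bool" where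
  "ordered_decomposition H u E D \<longleftrightarrow> decomposition H u E D \<and>
    (\<forall>s\<in>po_interval H u. \<forall>t\<in>po_interval H u. po_less H s t \<longrightarrow>
      (\<forall>x\<in>D s. \<forall>y\<in>D t. ea_le E x y))"

definition directed_decomposition ::
    "('h, 'm) po_monoid_scheme \<Rightarrow> 'h \<Rightarrow> ('a, 'n) effect_alg_scheme \<Rightarrow> ('h \<Rightarrow> 'a set) \<Rightarrow> bool" where
  "directed_decomposition H u E D \<longleftrightarrow> decomposition H u E D \<and>
    (\<forall>t\<in>po_interval H u. \<forall>x\<in>D t. \<forall>y\<in>D t.
      (\<exists>z\<in>D t. ea_le E x z \<and> ea_le E y z) \<and> (\<exists>z\<in>D t. ea_le E z x \<and> ea_le E z y))"

definition strong_decomposition ::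
    "('h, 'm) po_monoid_scheme \<Rightarrow> 'h \<Rightarrow> ('a, 'n) effect_alg_scheme \<Rightarrow> ('h \<Rightarrow> 'a set) \<Rightarrow> bool" where
  "strong_decomposition H u E D \<longleftrightarrow>
    ordered_decomposition H u E D \<and> directed_decomposition H u E D \<and>
    (\<exists>c. (\<forall>t\<in>po_interval H u. c t \<in> D t) \<and>
      (\<forall>v\<in>po_interval H u. \<forall>t\<in>po_interval H u. v \<otimes>\<^bsub>H\<^esub> t \<preceq>\<^bsub>H\<^esub> u \<longrightarrow>
        ea_plus E (c v) (c t) = Some (c (v \<otimes>\<^bsub>H\<^esub> t))) \<and>
      c u = ea_one E)"

definition strong_perfect ::
    "('h, 'm) po_monoid_scheme \<Rightarrow> 'h \<Rightarrow> ('a, 'n) effect_alg_scheme \<Rightarrow> bool" where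
  "strong_perfect H u E \<longleftrightarrow>
    effect_algebra E \<and> ea_RDP E \<and> (\<exists>D. strong_decomposition H u E D)"

definition Gamma_lex ::
    "('h, 'm) po_monoid_scheme \<Rightarrow> 'h \<Rightarrow> ('g, 'n) po_monoid_scheme \<Rightarrow> ('h \<times> 'g) effect_alg" where
  "Gamma_lex H u G = Gamma (lex_prod H G) (u, \<one>\<^bsub>G\<^esub>)"

text \<open>
  \<open>G\<close> represents \<open>E\<close> together with its decomposition \<open>D\<close>: some isomorphism of \<open>E\<close> onto
  \<open>\<Gamma>(H \<times> G, (u, 0))\<close> carries \<open>D t\<close> onto the elements with first coordinate \<open>t\<close>.

  The po-group \<open>G\<close> is determined by \<open>E\<close> and \<open>D\<close>, but not by \<open>E\<close> alone. Order the polynomial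
  ring \<open>\<int>[x]\<close> by the sign of the leading coefficient and take the lexicographic products
  \<open>H = \<int> \<times> \<int>[x]\<close>, \<open>u = (1, 0)\<close>. Then \<open>(n, p, m) \<mapsto> (n, x p + m)\<close> is an isomorphism of
  \<open>H \<times> \<int>\<close> onto \<open>H\<close> mapping \<open>(u, 0)\<close> to \<open>u\<close>, so \<open>\<Gamma>(H \<times> \<int>, (u, 0))\<close> and
  \<open>\<Gamma>(H \<times> 0, (u, 0))\<close> are isomorphic effect algebras. Uniqueness of \<open>G\<close> therefore refers
  to a given decomposition.
\<close>

definition lex_represents ::
    "('h, 'm) po_monoid_scheme \<Rightarrow> 'h \<Rightarrow> ('a, 'n) effect_alg_scheme \<Rightarrow> ('h \<Rightarrow> 'a set) \<Rightarrow>
     ('g, 'l) po_monoid_scheme \<Rightarrow> bool" where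
  "lex_represents H u E D G \<longleftrightarrow>
    (\<exists>f\<in>ea_iso E (Gamma_lex H u G). \<forall>t\<in>po_interval H u.
      f ` D t = {p \<in> carrier (Gamma_lex H u G). fst p = t})"

end

theory Submission
  imports Defs
begin

text \<open>
  Since \<open>0 < u\<close>, the sum of any two elements of the bottom level \<open>D 0\<close> is defined, so
  \<open>D 0\<close> is a conical cancellative commutative monoid; \<open>G\<close> is its group of differences. As
  \<open>D t\<close> is downwards directed, any \<open>x\<close> in \<open>D t\<close> has a common lower bound \<open>z\<close> in \<open>D t\<close>
  with \<open>c t\<close>, and writing \<open>x = z + a\<close>, \<open>c t = z + b\<close> with \<open>a\<close>, \<open>b\<close> in \<open>D 0\<close> gives the
  isomorphism \<open>x \<mapsto> (t, a - b)\<close>. It is onto because \<open>b \<le> c t\<close> for \<open>0 < t\<close>, and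
  \<open>z + a\<close> exists for \<open>t < u\<close>. Conversely, \<open>D t\<close> is the set of elements with first coordinate
  \<open>t\<close>. The positive cone of \<open>G\<close> is the bottom level, which yields RDP and, as \<open>G\<close> is
  directed, uniqueness.
\<close>

section \<open>Abelian po-groups and their positive cones\<close>

text \<open>Subtraction is the obstacle: \<open>x - c t\<close> has no meaning inside
  \<open>E\<close>, so both \<open>x\<close> and \<open>c t\<close> are measured from a base below
  them. Downward directedness is used twice, to find such a base and to compare two bases through a
  third one below both, which makes the difference independent of the choice. The family
  \<open>c\<close> supplies the origins of the levels. Since \<open>c v + c t = c (v + t)\<close>,
  the second coordinate is additive, and \<open>c u = 1\<close> places the top level on the negative
  cone of \<open>G\<close>. An isomorphism must also reflect definedness of sums. If the levels add
  up to less than \<open>u\<close>, the ordering of the levels gives this at once; if they add up to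
  \<open>u\<close>, one summand has to be compared with the complement of the other inside a single
  level, so order reflection within a level is needed as well.\<close>

lemma (in comm_group) div_eq_iff:
  assumes "a \<in> carrier G" "b \<in> carrier G" "c \<in> carrier G" "d \<in> carrier G"
  shows "a \<otimes> inv b = c \<otimes> inv d \<longleftrightarrow> a \<otimes> d = c \<otimes> b"
proof -
  have "a \<otimes> inv b = c \<otimes> inv d \<longleftrightarrow> a \<otimes> inv b \<otimes> (b \<otimes> d) = c \<otimes> inv d \<otimes> (b \<otimes> d)"
    using assms by simp
  also have "a \<otimes> inv b \<otimes> (b \<otimes> d) = a \<otimes> d \<otimes> (b \<otimes> inv b)"
    using assms by (simp only: m_ac inv_closed m_closed)
  also have "c \<otimes> inv d \<otimes> (b \<otimes> d) = c \<otimes> b \<otimes> (d \<otimes> inv d)"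
    using assms by (simp only: m_ac inv_closed m_closed)
  finally show ?thesis
    using assms by simp
qed

lemma (in comm_group) div_mult_div:
  assumes "a \<in> carrier G" "b \<in> carrier G" "c \<in> carrier G" "d \<in> carrier G"
  shows "(a \<otimes> inv b) \<otimes> (c \<otimes> inv d) = (a \<otimes> c) \<otimes> inv (b \<otimes> d)"
  using assms by (simp add: inv_mult m_ac)

context abelian_po_group
begin

lemma translate_iff:
  assumes "g \<in> carrier G" "h \<in> carrier G" "k \<in> carrier G"
  shows "g \<otimes> k \<preceq> h \<otimes> k \<longleftrightarrow> g \<preceq> h"
proof
  assume "g \<preceq> h"
  then show "g \<otimes> k \<preceq> h \<otimes> k"
    using po_translate[of g h \<one> k] assms by simp
next
  assume "g \<otimes> k \<preceq> h \<otimes> k"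
  then have "\<one> \<otimes> (g \<otimes> k) \<otimes> inv k \<preceq> \<one> \<otimes> (h \<otimes> k) \<otimes> inv k"
    using po_translate[of "g \<otimes> k" "h \<otimes> k" \<one> "inv k"] assms by simp
  then show "g \<preceq> h"
    using assms by (simp add: m_assoc)
qed

lemma le_div_iff:
  assumes "g \<in> carrier G" "h \<in> carrier G" "k \<in> carrier G"
  shows "g \<preceq> h \<otimes> inv k \<longleftrightarrow> g \<otimes> k \<preceq> h"
  using translate_iff[of g "h \<otimes> inv k" k] assms by (simp add: m_assoc)

lemma le_iff_div_pos:
  assumes "g \<in> carrier G" "h \<in> carrier G"
  shows "g \<preceq> h \<longleftrightarrow> h \<otimes> inv g \<in> po_pos G"
  using le_div_iff[of \<one> h g] assms by (simp add: po_pos_def)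

lemma pos_closed: "x \<in> po_pos G \<Longrightarrow> x \<in> carrier G"
  by (simp add: po_pos_def)

lemma one_pos: "\<one> \<in> po_pos G"
  by (simp add: po_pos_def po_refl)

lemma pos_mult:
  assumes "x \<in> po_pos G" "y \<in> po_pos G"
  shows "x \<otimes> y \<in> po_pos G"
proof -
  have "\<one> \<otimes> y \<preceq> x \<otimes> y"
    using assms translate_iff[of \<one> x y] by (simp add: po_pos_def)
  then show ?thesis
    using assms po_trans[of \<one> y "x \<otimes> y"] by (simp add: po_pos_def)
qed

lemma pos_mult_eq_one:
  assumes "x \<in> po_pos G" "y \<in> po_pos G" "x \<otimes> y = \<one>"
  shows "x = \<one>"
proof -
  have "\<one> \<otimes> x \<preceq> y \<otimes> x"
    using assms translate_iff[of \<one> y x] by (simp add: po_pos_def)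
  then have "x \<preceq> \<one>"
    using assms by (simp add: po_pos_def m_comm)
  then show ?thesis
    using assms po_antisym[of x \<one>] by (simp add: po_pos_def)
qed

lemma le_mult_pos:
  assumes "x \<in> carrier G" "y \<in> po_pos G"
  shows "x \<preceq> x \<otimes> y"
  using assms translate_iff[of \<one> y x] by (simp add: po_pos_def m_comm)

lemma inv_le_inv_iff:
  assumes "g \<in> carrier G" "h \<in> carrier G"
  shows "inv g \<preceq> inv h \<longleftrightarrow> h \<preceq> g"
  using le_iff_div_pos[of "inv g" "inv h"] le_iff_div_pos[of h g] assms by (simp add: m_comm)

lemma directed_down:
  assumes "po_directed G" "g \<in> carrier G" "h \<in> carrier G"
  obtains k where "k \<in> carrier G" "k \<preceq> g" "k \<preceq> h"
proof -
  obtain k where k: "k \<in> carrier G" "inv g \<preceq> k" "inv h \<preceq> k"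
    using assms unfolding po_directed_def by (meson inv_closed)
  have "inv k \<preceq> g" "inv k \<preceq> h"
    using k assms inv_le_inv_iff[of "inv g" k] inv_le_inv_iff[of k "inv g"]
      inv_le_inv_iff[of k "inv h"] by auto
  then show ?thesis
    using that k by blast
qed

text \<open>For an upper bound \<open>k\<close> of \<open>g\<close> and 0, both \<open>k\<close> and
  \<open>k - g\<close> are positive, and \<open>g\<close> is their difference.\<close>

lemma directed_pos_div:
  assumes "po_directed G" "g \<in> carrier G"
  obtains a b where "a \<in> po_pos G" "b \<in> po_pos G" "g = a \<otimes> inv b"
proof -
  obtain k where k: "k \<in> carrier G" "g \<preceq> k" "\<one> \<preceq> k"
    using assms unfolding po_directed_def by (meson one_closed)
  have "k \<otimes> inv g \<in> po_pos G"
    using k assms le_iff_div_pos by simp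
  moreover have "g = k \<otimes> inv (k \<otimes> inv g)"
    using k assms by (simp add: inv_mult m_assoc[symmetric])
  ultimately show ?thesis
    using that[of k "k \<otimes> inv g"] k by (simp add: po_pos_def)
qed

lemma strong_unit_nontrivial:
  assumes "strong_unit G u" "carrier G \<noteq> {\<one>}"
  shows "u \<noteq> \<one>"
proof
  assume "u = \<one>"
  then have le: "g \<preceq> \<one>" if "g \<in> carrier G" for g
    using that assms unfolding strong_unit_def by auto
  have "g = \<one>" if "g \<in> carrier G" for g
    using that le[of g] le[of "inv g"] inv_le_inv_iff[of g \<one>] po_antisym by simp
  then show False
    using assms by blast
qed

end

section \<open>Extending an isomorphism of cones to the groups\<close>

text \<open>In a directed group every element is a difference of positive ones, and the cone
  determines the order. An additive bijection of cones therefore extends to differences, so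
  uniqueness of \<open>G\<close> can be settled on the cone.\<close>

lemma po_isomorphic_if_cones:
  fixes G :: "('a, 'm) po_monoid_scheme" and K :: "('b, 'n) po_monoid_scheme"
  assumes "abelian_po_group G" "po_directed G" "abelian_po_group K" "po_directed K"
    and bij: "bij_betw \<phi> (po_pos G) (po_pos K)"
    and add: "\<And>x y. x \<in> po_pos G \<Longrightarrow> y \<in> po_pos G \<Longrightarrow> \<phi> (x \<otimes>\<^bsub>G\<^esub> y) = \<phi> x \<otimes>\<^bsub>K\<^esub> \<phi> y"
  shows "po_isomorphic G K"
proof -
  interpret G: abelian_po_group G by fact
  interpret K: abelian_po_group K by fact
  have pos: "\<phi> x \<in> po_pos K" "\<phi> x \<in> carrier K" if "x \<in> po_pos G" for x
    using that bij_betwE[OF bij] K.pos_closed by blast+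
  have eq_iff: "\<phi> a \<otimes>\<^bsub>K\<^esub> inv\<^bsub>K\<^esub> \<phi> b = \<phi> c \<otimes>\<^bsub>K\<^esub> inv\<^bsub>K\<^esub> \<phi> d \<longleftrightarrow>
      a \<otimes>\<^bsub>G\<^esub> inv\<^bsub>G\<^esub> b = c \<otimes>\<^bsub>G\<^esub> inv\<^bsub>G\<^esub> d"
    if "a \<in> po_pos G" "b \<in> po_pos G" "c \<in> po_pos G" "d \<in> po_pos G" for a b c d
  proof -
    have "\<phi> a \<otimes>\<^bsub>K\<^esub> inv\<^bsub>K\<^esub> \<phi> b = \<phi> c \<otimes>\<^bsub>K\<^esub> inv\<^bsub>K\<^esub> \<phi> d \<longleftrightarrow> \<phi> (a \<otimes>\<^bsub>G\<^esub> d) = \<phi> (c \<otimes>\<^bsub>G\<^esub> b)"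
      using that pos by (simp add: K.div_eq_iff add)
    also have "\<dots> \<longleftrightarrow> a \<otimes>\<^bsub>G\<^esub> d = c \<otimes>\<^bsub>G\<^esub> b"
      using bij that G.pos_mult by (auto simp: bij_betw_def inj_on_eq_iff)
    also have "\<dots> \<longleftrightarrow> a \<otimes>\<^bsub>G\<^esub> inv\<^bsub>G\<^esub> b = c \<otimes>\<^bsub>G\<^esub> inv\<^bsub>G\<^esub> d"
      using that G.pos_closed by (simp add: G.div_eq_iff)
    finally show ?thesis .
  qed
  \<comment> \<open>The value does not depend on \<open>a\<close> and \<open>b\<close> by
    \<open>eq_iff\<close>, whose other direction later gives injectivity.\<close>
  define F where "F g = (THE y. \<exists>a\<in>po_pos G. \<exists>b\<in>po_pos G.
      g = a \<otimes>\<^bsub>G\<^esub> inv\<^bsub>G\<^esub> b \<and> y = \<phi> a \<otimes>\<^bsub>K\<^esub> inv\<^bsub>K\<^esub> \<phi> b)" for g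
  have F: "F (a \<otimes>\<^bsub>G\<^esub> inv\<^bsub>G\<^esub> b) = \<phi> a \<otimes>\<^bsub>K\<^esub> inv\<^bsub>K\<^esub> \<phi> b" if "a \<in> po_pos G" "b \<in> po_pos G" for a b
    unfolding F_def
  proof (rule the_equality)
    fix y
    assume "\<exists>a'\<in>po_pos G. \<exists>b'\<in>po_pos G.
      a \<otimes>\<^bsub>G\<^esub> inv\<^bsub>G\<^esub> b = a' \<otimes>\<^bsub>G\<^esub> inv\<^bsub>G\<^esub> b' \<and> y = \<phi> a' \<otimes>\<^bsub>K\<^esub> inv\<^bsub>K\<^esub> \<phi> b'"
    then show "y = \<phi> a \<otimes>\<^bsub>K\<^esub> inv\<^bsub>K\<^esub> \<phi> b"
      using eq_iff that by metis
  qed (use that in blast)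
  have div: "\<exists>a\<in>po_pos G. \<exists>b\<in>po_pos G. g = a \<otimes>\<^bsub>G\<^esub> inv\<^bsub>G\<^esub> b" if "g \<in> carrier G" for g
    using G.directed_pos_div[OF assms(2) that] by metis
  have closed: "F g \<in> carrier K" if "g \<in> carrier G" for g
    using div[OF that] F pos by auto
  have hom: "F (g \<otimes>\<^bsub>G\<^esub> h) = F g \<otimes>\<^bsub>K\<^esub> F h" if gh: "g \<in> carrier G" "h \<in> carrier G" for g h
  proof -
    obtain a b c d where ab: "a \<in> po_pos G" "b \<in> po_pos G" "g = a \<otimes>\<^bsub>G\<^esub> inv\<^bsub>G\<^esub> b"
      and cd: "c \<in> po_pos G" "d \<in> po_pos G" "h = c \<otimes>\<^bsub>G\<^esub> inv\<^bsub>G\<^esub> d"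
      using div gh by metis
    have "g \<otimes>\<^bsub>G\<^esub> h = (a \<otimes>\<^bsub>G\<^esub> c) \<otimes>\<^bsub>G\<^esub> inv\<^bsub>G\<^esub> (b \<otimes>\<^bsub>G\<^esub> d)"
      using ab cd G.pos_closed by (simp add: G.div_mult_div)
    then have "F (g \<otimes>\<^bsub>G\<^esub> h) = (\<phi> a \<otimes>\<^bsub>K\<^esub> \<phi> c) \<otimes>\<^bsub>K\<^esub> inv\<^bsub>K\<^esub> (\<phi> b \<otimes>\<^bsub>K\<^esub> \<phi> d)"
      using ab cd by (simp add: F G.pos_mult add)
    also have "\<dots> = F g \<otimes>\<^bsub>K\<^esub> F h"
      using ab cd pos by (simp add: F K.div_mult_div)
    finally show ?thesis .
  qed
  have inj: "inj_on F (carrier G)"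
  proof (rule inj_onI)
    fix g h
    assume "g \<in> carrier G" "h \<in> carrier G" "F g = F h"
    then show "g = h"
      using div F eq_iff by metis
  qed
  have F_pos: "F x = \<phi> x" if x: "x \<in> po_pos G" for x
  proof -
    \<comment> \<open>The image of 0 is idempotent, hence 0 in the group \<open>K\<close>.\<close>
    have "\<phi> \<one>\<^bsub>G\<^esub> \<otimes>\<^bsub>K\<^esub> \<phi> \<one>\<^bsub>G\<^esub> = \<phi> \<one>\<^bsub>G\<^esub>"
      using add[OF G.one_pos G.one_pos] by simp
    then have "\<phi> \<one>\<^bsub>G\<^esub> = \<one>\<^bsub>K\<^esub>"
      using pos(2)[OF G.one_pos] by (metis K.l_cancel_one)
    then show ?thesis
      using F[OF x G.one_pos] x pos G.pos_closed by simp
  qed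
  have surj: "y \<in> F ` carrier G" if y: "y \<in> carrier K" for y
  proof -
    obtain p q where pq: "p \<in> po_pos K" "q \<in> po_pos K" "y = p \<otimes>\<^bsub>K\<^esub> inv\<^bsub>K\<^esub> q"
      by (rule K.directed_pos_div[OF assms(4) y])
    then obtain a b where "a \<in> po_pos G" "b \<in> po_pos G" "p = \<phi> a" "q = \<phi> b"
      using bij by (metis bij_betw_imp_surj_on imageE)
    then show ?thesis
      using pq F by (metis G.inv_closed G.m_closed G.pos_closed imageI)
  qed
  have iso: "F \<in> iso G K"
    using hom closed inj surj by (auto simp: iso_def hom_def bij_betw_def)
  then interpret FH: group_hom G K F
    by unfold_locales (simp add: iso_def)
  \<comment> \<open>An injective map that sends cone onto cone also reflects positivity; applied to
    \<open>h - g\<close> this gives the order equivalence.\<close>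
  have pos_iff: "F g \<in> po_pos K \<longleftrightarrow> g \<in> po_pos G" if "g \<in> carrier G" for g
  proof
    assume "F g \<in> po_pos K"
    then obtain x where "x \<in> po_pos G" "F g = F x"
      using bij F_pos by (metis bij_betw_imp_surj_on imageE)
    then show "g \<in> po_pos G"
      using inj that G.pos_closed by (metis inj_onD)
  qed (use F_pos pos in auto)
  have "g \<preceq>\<^bsub>G\<^esub> h \<longleftrightarrow> F g \<preceq>\<^bsub>K\<^esub> F h" if "g \<in> carrier G" "h \<in> carrier G" for g h
    using that pos_iff[of "h \<otimes>\<^bsub>G\<^esub> inv\<^bsub>G\<^esub> g"] by (simp add: G.le_iff_div_pos K.le_iff_div_pos closed)
  then show ?thesis
    using iso unfolding po_isomorphic_def by blast
qed


section \<open>The difference group of a conical cancellative monoid\<close>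

text \<open>Cancellation makes equality of formal differences transitive; conicality makes the
  induced order antisymmetric.\<close>

locale conical_comm_monoid = comm_monoid M for M (structure) +
  assumes cancel: "\<lbrakk>x \<in> carrier M; y \<in> carrier M; z \<in> carrier M; x \<otimes> z = y \<otimes> z\<rbrakk> \<Longrightarrow> x = y"
    and conical: "\<lbrakk>x \<in> carrier M; y \<in> carrier M; x \<otimes> y = \<one>\<rbrakk> \<Longrightarrow> x = \<one>"

text \<open>The formal difference \<open>a - b\<close> as a full equivalence class of pairs, so that
  equal differences are equal sets.\<close>

definition diff_class :: "('a, 'm) monoid_scheme \<Rightarrow> 'a \<Rightarrow> 'a \<Rightarrow> ('a \<times> 'a) set" where
  "diff_class M a b = {(c, d). c \<in> carrier M \<and> d \<in> carrier M \<and> a \<otimes>\<^bsub>M\<^esub> d = c \<otimes>\<^bsub>M\<^esub> b}"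

text \<open>All representatives yield the same class, so this is a union of copies of one set and no
  representative has to be chosen.\<close>

definition diff_mult ::
    "('a, 'm) monoid_scheme \<Rightarrow> ('a \<times> 'a) set \<Rightarrow> ('a \<times> 'a) set \<Rightarrow> ('a \<times> 'a) set" where
  "diff_mult M X Y = (\<Union>(a, b)\<in>X. \<Union>(c, d)\<in>Y. diff_class M (a \<otimes>\<^bsub>M\<^esub> c) (b \<otimes>\<^bsub>M\<^esub> d))"

text \<open>The order is chosen so that the positive cone is the image of \<open>M\<close> under
  \<open>m \<mapsto> m - 0\<close>.\<close>

definition diff_group :: "('a, 'm) monoid_scheme \<Rightarrow> ('a \<times> 'a) set po_monoid" where
  "diff_group M =
    \<lparr>carrier = case_prod (diff_class M) ` (carrier M \<times> carrier M),
     mult = diff_mult M,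
     one = diff_class M \<one>\<^bsub>M\<^esub> \<one>\<^bsub>M\<^esub>,
     po_le = (\<lambda>X Y. \<exists>m\<in>carrier M. Y = diff_mult M X (diff_class M m \<one>\<^bsub>M\<^esub>))\<rparr>"

context conical_comm_monoid
begin

lemma cancel_iff:
  assumes "x \<in> carrier M" "y \<in> carrier M" "z \<in> carrier M"
  shows "x \<otimes> z = y \<otimes> z \<longleftrightarrow> x = y"
  using cancel assms by blast

lemma diff_class_eq_iff:
  assumes [simp]: "a \<in> carrier M" "b \<in> carrier M" "c \<in> carrier M" "d \<in> carrier M"
  shows "diff_class M a b = diff_class M c d \<longleftrightarrow> a \<otimes> d = c \<otimes> b"
proof
  assume "diff_class M a b = diff_class M c d"
  moreover have "(c, d) \<in> diff_class M c d"
    by (simp add: diff_class_def)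
  ultimately have "(c, d) \<in> diff_class M a b"
    by simp
  then show "a \<otimes> d = c \<otimes> b"
    by (simp add: diff_class_def)
next
  assume eq: "a \<otimes> d = c \<otimes> b"
  have "a \<otimes> q = p \<otimes> b \<longleftrightarrow> c \<otimes> q = p \<otimes> d" if [simp]: "p \<in> carrier M" "q \<in> carrier M" for p q
  proof -
    \<comment> \<open>Adding \<open>d\<close> turns the condition on \<open>(p, q)\<close> for the
      first class into the one for the second with \<open>b\<close> added; cancelling
      \<open>b\<close> finishes.\<close>
    have "a \<otimes> q = p \<otimes> b \<longleftrightarrow> (a \<otimes> q) \<otimes> d = (p \<otimes> b) \<otimes> d"
      by (simp add: cancel_iff)
    also have "(a \<otimes> q) \<otimes> d = (a \<otimes> d) \<otimes> q"
      by (simp add: m_ac)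
    also have "\<dots> = (c \<otimes> q) \<otimes> b"
      by (simp add: eq m_ac)
    also have "(p \<otimes> b) \<otimes> d = (p \<otimes> d) \<otimes> b"
      by (simp add: m_ac)
    finally show ?thesis
      by (simp add: cancel_iff)
  qed
  then show "diff_class M a b = diff_class M c d"
    by (auto simp: diff_class_def)
qed

lemma diff_mult_class:
  assumes [simp]: "a \<in> carrier M" "b \<in> carrier M" "c \<in> carrier M" "d \<in> carrier M"
  shows "diff_mult M (diff_class M a b) (diff_class M c d) = diff_class M (a \<otimes> c) (b \<otimes> d)"
proof -
  have "diff_class M (a' \<otimes> c') (b' \<otimes> d') = diff_class M (a \<otimes> c) (b \<otimes> d)"
    if "(a', b') \<in> diff_class M a b" "(c', d') \<in> diff_class M c d" for a' b' c' d'
  proof -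
    have [simp]: "a' \<in> carrier M" "b' \<in> carrier M" "c' \<in> carrier M" "d' \<in> carrier M"
      and eq: "a \<otimes> b' = a' \<otimes> b" "c \<otimes> d' = c' \<otimes> d"
      using that by (auto simp: diff_class_def)
    have "(a \<otimes> b') \<otimes> (c \<otimes> d') = (a' \<otimes> b) \<otimes> (c' \<otimes> d)"
      by (simp add: eq)
    then have "(a \<otimes> c) \<otimes> (b' \<otimes> d') = (a' \<otimes> c') \<otimes> (b \<otimes> d)"
      by (simp add: m_ac)
    then show ?thesis
      by (simp add: diff_class_eq_iff)
  qed
  moreover have "(a, b) \<in> diff_class M a b" "(c, d) \<in> diff_class M c d"
    by (simp_all add: diff_class_def)
  ultimately show ?thesis
    unfolding diff_mult_def by blast
qed

lemma diff_group_simps: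
  "mult (diff_group M) = diff_mult M"
  "one (diff_group M) = diff_class M \<one> \<one>"
  "po_le (diff_group M) X Y \<longleftrightarrow> (\<exists>m\<in>carrier M. Y = diff_mult M X (diff_class M m \<one>))"
  by (simp_all add: diff_group_def)

lemma diff_groupI:
  "a \<in> carrier M \<Longrightarrow> b \<in> carrier M \<Longrightarrow> diff_class M a b \<in> carrier (diff_group M)"
  by (auto simp: diff_group_def)

lemma diff_groupE:
  assumes "X \<in> carrier (diff_group M)"
  obtains a b where "a \<in> carrier M" "b \<in> carrier M" "X = diff_class M a b"
  using assms by (auto simp: diff_group_def)

lemma diff_group_comm_group: "comm_group (diff_group M)"
proof (rule comm_groupI)
  fix X
  assume "X \<in> carrier (diff_group M)"
  then obtain a b where ab: "a \<in> carrier M" "b \<in> carrier M" "X = diff_class M a b"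
    by (rule diff_groupE)
  then have "diff_class M b a \<otimes>\<^bsub>diff_group M\<^esub> X = \<one>\<^bsub>diff_group M\<^esub>"
    by (simp add: diff_group_simps diff_mult_class diff_class_eq_iff m_comm)
  then show "\<exists>Y\<in>carrier (diff_group M). Y \<otimes>\<^bsub>diff_group M\<^esub> X = \<one>\<^bsub>diff_group M\<^esub>"
    using ab diff_groupI by blast
qed (auto elim!: diff_groupE simp: diff_group_simps diff_mult_class diff_groupI m_ac)

lemma diff_group_le_iff:
  assumes [simp]: "a \<in> carrier M" "b \<in> carrier M" "c \<in> carrier M" "d \<in> carrier M"
  shows "po_le (diff_group M) (diff_class M a b) (diff_class M c d) \<longleftrightarrow>
    (\<exists>m\<in>carrier M. c \<otimes> b = a \<otimes> d \<otimes> m)"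
proof -
  have "diff_class M c d = diff_mult M (diff_class M a b) (diff_class M m \<one>) \<longleftrightarrow>
      c \<otimes> b = a \<otimes> d \<otimes> m" if "m \<in> carrier M" for m
    using that by (simp add: diff_mult_class diff_class_eq_iff m_ac)
  then show ?thesis
    by (auto simp: diff_group_simps)
qed

lemma diff_group_abelian_po_group: "abelian_po_group (diff_group M)"
proof -
  interpret D: comm_group "diff_group M"
    by (rule diff_group_comm_group)
  have inD: "diff_class M m \<one> \<in> carrier (diff_group M)" if "m \<in> carrier M" for m
    using that by (simp add: diff_groupI)
  have le: "po_le (diff_group M) X Y \<longleftrightarrow>
      (\<exists>m\<in>carrier M. Y = X \<otimes>\<^bsub>diff_group M\<^esub> diff_class M m \<one>)" for X Y
    by (simp add: diff_group_simps)
  have mm: "diff_class M m \<one> \<otimes>\<^bsub>diff_group M\<^esub> diff_class M n \<one> = diff_class M (m \<otimes> n) \<one>"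
    if "m \<in> carrier M" "n \<in> carrier M" for m n
    using that by (simp add: diff_group_simps diff_mult_class)
  show ?thesis
  proof (intro abelian_po_group.intro po_group.intro po_group_axioms.intro)
    show "po_le (diff_group M) X X" if "X \<in> carrier (diff_group M)" for X
      using that unfolding le by (intro bexI[of _ \<one>]) (auto simp flip: diff_group_simps(2))
  next
    fix X Y
    assume X: "X \<in> carrier (diff_group M)" and Y: "Y \<in> carrier (diff_group M)"
      and "po_le (diff_group M) X Y" "po_le (diff_group M) Y X"
    then obtain m n where m: "m \<in> carrier M" "Y = X \<otimes>\<^bsub>diff_group M\<^esub> diff_class M m \<one>"
      and n: "n \<in> carrier M" "X = Y \<otimes>\<^bsub>diff_group M\<^esub> diff_class M n \<one>"
      unfolding le by blast
    \<comment> \<open>Two successive increments \<open>m\<close> and \<open>n\<close> lead back to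
      \<open>X\<close>, so \<open>m + n = 0\<close>, and conicality forces
      \<open>m = 0\<close>.\<close>
    then have "X = X \<otimes>\<^bsub>diff_group M\<^esub> diff_class M (m \<otimes> n) \<one>"
      using X by (metis D.m_assoc inD mm)
    then have "diff_class M (m \<otimes> n) \<one> = \<one>\<^bsub>diff_group M\<^esub>"
      using X m n by (metis D.l_cancel_one' inD m_closed)
    then have "m \<otimes> n = \<one>"
      using m n by (simp add: diff_group_simps diff_class_eq_iff)
    then have "m = \<one>"
      using m n conical by blast
    then show "X = Y"
      using m X by (simp flip: diff_group_simps(2))
  next
    fix X Y Z
    assume "X \<in> carrier (diff_group M)" "po_le (diff_group M) X Y" "po_le (diff_group M) Y Z"
    then show "po_le (diff_group M) X Z"
      unfolding le by (metis D.m_assoc inD m_closed mm)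
  next
    fix X Y K L
    assume C: "X \<in> carrier (diff_group M)" "K \<in> carrier (diff_group M)" "L \<in> carrier (diff_group M)"
      and "po_le (diff_group M) X Y"
    then obtain m where m: "m \<in> carrier M" "Y = X \<otimes>\<^bsub>diff_group M\<^esub> diff_class M m \<one>"
      unfolding le by blast
    then have "K \<otimes>\<^bsub>diff_group M\<^esub> Y \<otimes>\<^bsub>diff_group M\<^esub> L =
        K \<otimes>\<^bsub>diff_group M\<^esub> X \<otimes>\<^bsub>diff_group M\<^esub> L \<otimes>\<^bsub>diff_group M\<^esub> diff_class M m \<one>"
      using C inD by (simp add: D.m_ac)
    then show "po_le (diff_group M) (K \<otimes>\<^bsub>diff_group M\<^esub> X \<otimes>\<^bsub>diff_group M\<^esub> L)
        (K \<otimes>\<^bsub>diff_group M\<^esub> Y \<otimes>\<^bsub>diff_group M\<^esub> L)"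
      unfolding le using m by blast
  qed (fact D.is_group diff_group_comm_group)+
qed

lemma diff_group_directed: "po_directed (diff_group M)"
proof -
  have "\<exists>Z\<in>carrier (diff_group M). po_le (diff_group M) X Z \<and> po_le (diff_group M) Y Z"
    if X': "X \<in> carrier (diff_group M)" and Y': "Y \<in> carrier (diff_group M)" for X Y
  proof -
    obtain a b where ab [simp]: "a \<in> carrier M" "b \<in> carrier M" and X: "X = diff_class M a b"
      by (rule diff_groupE[OF X'])
    obtain c d where cd [simp]: "c \<in> carrier M" "d \<in> carrier M" and Y: "Y = diff_class M c d"
      by (rule diff_groupE[OF Y'])
    \<comment> \<open>The element \<open>a + c\<close> exceeds \<open>a - b\<close> by
      \<open>b + c\<close> and exceeds \<open>c - d\<close> by \<open>a + d\<close>.\<close>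
    have "po_le (diff_group M) X (diff_class M (a \<otimes> c) \<one>)"
      unfolding X by (subst diff_group_le_iff) (auto simp: m_ac intro!: bexI[of _ "b \<otimes> c"])
    moreover have "po_le (diff_group M) Y (diff_class M (a \<otimes> c) \<one>)"
      unfolding Y by (subst diff_group_le_iff) (auto simp: m_ac intro!: bexI[of _ "a \<otimes> d"])
    ultimately show ?thesis
      using diff_groupI by (meson ab cd m_closed one_closed)
  qed
  then show ?thesis
    by (simp add: po_directed_def)
qed

end


section \<open>Effect algebras and intervals\<close>

context abelian_po_group
begin

lemma Gamma_plus_iff:
  assumes "u \<in> carrier G" "a \<in> po_interval G u" "b \<in> po_interval G u"
  shows "ea_plus (Gamma G u) a b = Some c \<longleftrightarrow> c = a \<otimes> b \<and> c \<in> po_interval G u"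
proof -
  have "a \<otimes> b \<in> po_pos G"
    using assms pos_mult[of a b] by (simp add: po_interval_def po_pos_def)
  then show ?thesis
    using assms le_div_iff[of a u b] by (auto simp: Gamma_def po_interval_def po_pos_def)
qed

lemma Gamma_le_iff:
  assumes "u \<in> carrier G" and a: "a \<in> po_interval G u" and b: "b \<in> po_interval G u"
  shows "ea_le (Gamma G u) a b \<longleftrightarrow> a \<preceq> b"
proof
  assume "ea_le (Gamma G u) a b"
  then obtain c where c: "c \<in> po_interval G u" "b = a \<otimes> c"
    unfolding ea_le_def using Gamma_plus_iff[OF assms(1,2)] by (auto simp: Gamma_def)
  then show "a \<preceq> b"
    using a le_mult_pos[of a c] by (simp add: po_interval_def po_pos_def)
next
  assume ab: "a \<preceq> b"
  have C: "a \<in> carrier G" "b \<in> carrier G" "\<one> \<preceq> a" "b \<preceq> u"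
    using a b by (auto simp: po_interval_def)
  have d: "b \<otimes> inv a \<in> po_pos G"
    using C ab le_iff_div_pos by blast
  \<comment> \<open>The difference stays in the interval because
    \<open>b - a \<le> b \<le> u\<close>.\<close>
  have "b \<otimes> inv a \<preceq> b \<otimes> inv a \<otimes> a"
    using C d le_mult_pos[of "b \<otimes> inv a" a] by (simp add: po_pos_def)
  then have "b \<otimes> inv a \<preceq> b"
    using C by (simp add: m_assoc)
  then have c: "b \<otimes> inv a \<in> po_interval G u"
    using C d assms(1) po_trans[of "b \<otimes> inv a" b u] by (simp add: po_interval_def po_pos_def)
  have "ea_plus (Gamma G u) a (b \<otimes> inv a) = Some b"
    using assms c C by (simp add: Gamma_plus_iff m_comm[of a] m_assoc)
  then show "ea_le (Gamma G u) a b"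
    unfolding ea_le_def using c by (intro bexI) (simp_all add: Gamma_def)
qed

end

section \<open>Transport along isomorphisms of effect algebras\<close>

text \<open>The direction from \<open>F\<close> to \<open>E\<close> rests on the inverse being a
  homomorphism: a bijective homomorphism alone may create sums that were undefined in
  \<open>E\<close>.\<close>

lemma ea_iso_plus_iff:
  assumes "f \<in> ea_iso E F" "a \<in> carrier E" "b \<in> carrier E" "c \<in> carrier E"
  shows "ea_plus F (f a) (f b) = Some (f c) \<longleftrightarrow> ea_plus E a b = Some c"
proof -
  have f: "bij_betw f (carrier E) (carrier F)" "f \<in> ea_hom E F"
    "inv_into (carrier E) f \<in> ea_hom F E"
    using assms by (auto simp: ea_iso_def)
  have g: "ea_plus E (inv_into (carrier E) f x) (inv_into (carrier E) f y) =
      Some (inv_into (carrier E) f z)"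
    if "x \<in> carrier F" "y \<in> carrier F" "ea_plus F x y = Some z" for x y z
    using f(3) that by (simp add: ea_hom_def)
  have fx: "f x \<in> carrier F" "inv_into (carrier E) f (f x) = x" if "x \<in> carrier E" for x
    using f(1) that by (auto simp: bij_betw_def)
  have "ea_plus F (f a) (f b) = Some (f c) \<Longrightarrow> ea_plus E a b = Some c"
    using g[of "f a" "f b" "f c"] assms(2-) by (simp add: fx)
  moreover have "ea_plus E a b = Some c \<Longrightarrow> ea_plus F (f a) (f b) = Some (f c)"
    using f(2) assms(2-) by (simp add: ea_hom_def)
  ultimately show ?thesis
    by blast
qed

lemma ea_iso_le_iff:
  assumes "f \<in> ea_iso E F" "a \<in> carrier E" "b \<in> carrier E"
  shows "ea_le F (f a) (f b) \<longleftrightarrow> ea_le E a b"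
proof -
  have "f ` carrier E = carrier F"
    using assms by (simp add: ea_iso_def bij_betw_def)
  then have "ea_le F (f a) (f b) \<longleftrightarrow> (\<exists>c\<in>carrier E. ea_plus F (f a) (f c) = Some (f b))"
    unfolding ea_le_def by (metis image_iff)
  then show ?thesis
    using ea_iso_plus_iff[OF assms(1)] assms(2,3) by (simp add: ea_le_def)
qed

lemma ea_iso_RDP:
  assumes "f \<in> ea_iso E F" "effect_algebra E" "ea_RDP E"
    and F_closed: "\<And>x y z. \<lbrakk>x \<in> carrier F; y \<in> carrier F; ea_plus F x y = Some z\<rbrakk> \<Longrightarrow> z \<in> carrier F"
  shows "ea_RDP F"
  unfolding ea_RDP_def
proof (intro ballI allI impI)
  fix a1 a2 b1 b2 s
  assume C: "a1 \<in> carrier F" "a2 \<in> carrier F" "b1 \<in> carrier F" "b2 \<in> carrier F"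
    and eq: "ea_plus F a1 a2 = Some s \<and> ea_plus F b1 b2 = Some s"
  have onto: "f ` carrier E = carrier F"
    using assms by (simp add: ea_iso_def bij_betw_def)
  have pre: "\<exists>x\<in>carrier E. a = f x" if "a \<in> carrier F" for a
    using that unfolding onto[symmetric] by blast
  obtain x1 x2 where x12: "x1 \<in> carrier E" "a1 = f x1" "x2 \<in> carrier E" "a2 = f x2"
    using pre C(1,2) by blast
  obtain y1 y2 where y12: "y1 \<in> carrier E" "b1 = f y1" "y2 \<in> carrier E" "b2 = f y2"
    using pre C(3,4) by blast
  \<comment> \<open>Closure of \<open>F\<close> under its sums puts \<open>s\<close> in the carrier,
    so the common sum has a preimage too.\<close>
  obtain w where w: "w \<in> carrier E" "s = f w"
    using pre F_closed C(1,2) eq by blast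
  note x = x12(1,3) y12(1,3) w(1) and f = x12(2,4) y12(2,4) w(2)
  have "ea_plus E x1 x2 = Some w \<and> ea_plus E y1 y2 = Some w"
    using eq ea_iso_plus_iff[OF assms(1) x(1,2,5)] ea_iso_plus_iff[OF assms(1) x(3,4,5)] f
    by simp
  then obtain c11 c12 c21 c22 where
    c: "c11 \<in> carrier E" "c12 \<in> carrier E" "c21 \<in> carrier E" "c22 \<in> carrier E"
    and sums: "ea_plus E c11 c12 = Some x1" "ea_plus E c21 c22 = Some x2"
      "ea_plus E c11 c21 = Some y1" "ea_plus E c12 c22 = Some y2"
    using assms(3)[unfolded ea_RDP_def, rule_format, OF x(1-4), of w] by blast
  have "ea_plus F (f c11) (f c12) = Some a1" "ea_plus F (f c21) (f c22) = Some a2"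
    "ea_plus F (f c11) (f c21) = Some b1" "ea_plus F (f c12) (f c22) = Some b2"
    using sums x c by (simp_all add: f ea_iso_plus_iff[OF assms(1)])
  then show "\<exists>c11\<in>carrier F. \<exists>c12\<in>carrier F. \<exists>c21\<in>carrier F. \<exists>c22\<in>carrier F.
      ea_plus F c11 c12 = Some a1 \<and> ea_plus F c21 c22 = Some a2 \<and>
      ea_plus F c11 c21 = Some b1 \<and> ea_plus F c12 c22 = Some b2"
    using c onto by blast
qed

text \<open>A relational form of the partial sum with membership built in, so that reassociation
  produces the intermediate sum together with its existence.\<close>

definition ea_sum :: "('a, 'm) effect_alg_scheme \<Rightarrow> 'a \<Rightarrow> 'a \<Rightarrow> 'a \<Rightarrow> bool" where
  "ea_sum E a b c \<longleftrightarrow> a \<in> carrier E \<and> b \<in> carrier E \<and> ea_plus E a b = Some c"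

section \<open>Cancellation, positivity and definedness of partial sums\<close>

context effect_algebra
begin

lemma sum_closed:
  assumes "ea_sum E a b c"
  shows "a \<in> carrier E" "b \<in> carrier E" "c \<in> carrier E"
  using assms ea_plus_closed by (auto simp: ea_sum_def)

lemma sum_unique: "ea_sum E a b c \<Longrightarrow> ea_sum E a b d \<Longrightarrow> c = d"
  by (simp add: ea_sum_def)

lemma sum_comm: "ea_sum E a b c \<Longrightarrow> ea_sum E b a c"
  by (simp add: ea_sum_def ea_comm)

lemma sum_assoc:
  assumes "ea_sum E a b x" "ea_sum E x c y"
  obtains z where "ea_sum E b c z" "ea_sum E a z y"
proof -
  have C: "a \<in> carrier E" "b \<in> carrier E" "c \<in> carrier E"
    using assms sum_closed by blast+
  have "Option.bind (ea_plus E b c) (ea_plus E a) = Some y"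
    using assms ea_assoc[OF C] by (simp add: ea_sum_def)
  then obtain z where "ea_plus E b c = Some z" "ea_plus E a z = Some y"
    by (auto simp: bind_eq_Some_conv)
  then show ?thesis
    using that[of z] C ea_plus_closed[of b c z] by (simp add: ea_sum_def)
qed

lemma sum_assoc':
  assumes "ea_sum E b c z" "ea_sum E a z y"
  obtains x where "ea_sum E a b x" "ea_sum E x c y"
proof -
  obtain x where "ea_sum E b a x" "ea_sum E c x y"
    by (rule sum_assoc[OF sum_comm[OF assms(1)] sum_comm[OF assms(2)]])
  then show ?thesis
    using that sum_comm by blast
qed

lemma compl:
  assumes "a \<in> carrier E"
  shows "ea_sum E a b (ea_one E) \<longleftrightarrow> b = ea_compl E a"
proof -
  have *: "\<exists>!b. ea_sum E a b (ea_one E)"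
    using ea_compl_unique[OF assms] assms by (simp add: ea_sum_def)
  have "ea_compl E a = (THE b. ea_sum E a b (ea_one E))"
    using assms by (simp add: ea_compl_def ea_sum_def)
  then show ?thesis
    using theI'[OF *] the1_equality[OF *] by metis
qed

lemma sum_compl: "a \<in> carrier E \<Longrightarrow> ea_sum E a (ea_compl E a) (ea_one E)"
  by (simp add: compl)

lemma compl_closed: "a \<in> carrier E \<Longrightarrow> ea_compl E a \<in> carrier E"
  using sum_compl sum_closed by blast

lemma compl_compl: "a \<in> carrier E \<Longrightarrow> ea_compl E (ea_compl E a) = a"
  using compl[OF compl_closed] sum_comm[OF sum_compl] by metis

text \<open>Adding the complement of \<open>c\<close> to \<open>a + b = a + d\<close> shows that
  \<open>b\<close> and \<open>d\<close> are both the complement of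
  \<open>a + ea_compl E c\<close>.\<close>

lemma sum_cancel:
  assumes "ea_sum E a b c" "ea_sum E a d c"
  shows "b = d"
proof -
  have C: "b \<in> carrier E" "d \<in> carrier E" "c \<in> carrier E"
    using assms sum_closed by blast+
  note c = sum_compl[OF C(3)]
  obtain y where y: "ea_sum E a (ea_compl E c) y" "ea_sum E b y (ea_one E)"
    by (rule sum_assoc[OF sum_comm[OF assms(1)] c])
  obtain z where "ea_sum E a (ea_compl E c) z" "ea_sum E d z (ea_one E)"
    by (rule sum_assoc[OF sum_comm[OF assms(2)] c])
  then have "ea_sum E y d (ea_one E)"
    using y(1) sum_comm sum_unique by blast
  then show ?thesis
    using sum_comm[OF y(2)] compl[OF sum_closed(1)] by metis
qed

lemma sum_with_one: "ea_sum E a (ea_one E) b \<Longrightarrow> a = ea_zero E"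
  using ea_one_max by (simp add: ea_sum_def)

text \<open>The complement of 1 can be added to 1, so it is 0 and \<open>1 + 0 = 1\<close>. Writing
  1 as \<open>a\<close> plus its complement and reassociating shows that \<open>a + 0\<close> and
  \<open>a\<close> have the same complement.\<close>

lemma sum_zero:
  assumes "a \<in> carrier E"
  shows "ea_sum E a (ea_zero E) a"
proof -
  have "ea_sum E (ea_one E) (ea_zero E) (ea_one E)"
    using sum_compl[OF ea_one_closed] sum_with_one[of "ea_compl E (ea_one E)"] sum_comm
    by metis
  then obtain z where z: "ea_sum E a (ea_zero E) z" "ea_sum E (ea_compl E a) z (ea_one E)"
    by (rule sum_assoc[OF sum_comm[OF sum_compl[OF assms]]])
  then have "z = a"
    using assms compl[OF compl_closed] compl_compl by simp
  then show ?thesis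
    using z by simp
qed

lemma sum_zero_left: "a \<in> carrier E \<Longrightarrow> ea_sum E (ea_zero E) a a"
  by (rule sum_comm[OF sum_zero])

text \<open>Reassociating \<open>(a + b) + 1\<close> shows that \<open>b + 1\<close> is defined.
  Hence \<open>b = 0\<close>, and then \<open>a = a + 0 = 0\<close>.\<close>

lemma sum_eq_zero:
  assumes "ea_sum E a b (ea_zero E)"
  shows "a = ea_zero E"
proof -
  obtain z where "ea_sum E b (ea_one E) z" "ea_sum E a z (ea_one E)"
    by (rule sum_assoc[OF assms sum_zero_left[OF ea_one_closed]])
  moreover from this have "b = ea_zero E"
    using sum_with_one by blast
  ultimately show ?thesis
    using assms sum_zero[of a] sum_closed(1)[OF assms] sum_unique by metis
qed

text \<open>Regrouping \<open>(z + a) + (w + b)\<close> as \<open>(z + w) + (a + b)\<close>; the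
  point is that the two new inner sums exist. It separates the bases from the increments when
  coordinates are added.\<close>

lemma sum_interchange:
  assumes "ea_sum E z a x" "ea_sum E w b y" "ea_sum E x y s"
  obtains p q where "ea_sum E z w p" "ea_sum E a b q" "ea_sum E p q s"
proof -
  obtain r where r: "ea_sum E a y r" "ea_sum E z r s"
    by (rule sum_assoc[OF assms(1,3)])
  obtain q where q: "ea_sum E a b q" "ea_sum E q w r"
    by (rule sum_assoc'[OF sum_comm[OF assms(2)] r(1)])
  obtain p where "ea_sum E z w p" "ea_sum E p q s"
    by (rule sum_assoc'[OF sum_comm[OF q(2)] r(2)])
  then show ?thesis
    using that q by blast
qed

lemma le_iff_sum:
  assumes "a \<in> carrier E"
  shows "ea_le E a b \<longleftrightarrow> (\<exists>c. ea_sum E a c b)"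
  using assms by (auto simp: ea_le_def ea_sum_def)

text \<open>This turns definedness into an order question, which the ordering of the levels can
  answer.\<close>

lemma sum_defined_iff:
  assumes "a \<in> carrier E" "b \<in> carrier E"
  shows "(\<exists>c. ea_sum E a b c) \<longleftrightarrow> ea_le E a (ea_compl E b)"
proof
  assume "\<exists>c. ea_sum E a b c"
  then obtain c where c: "ea_sum E b a c"
    using sum_comm by blast
  then have "ea_sum E c (ea_compl E c) (ea_one E)"
    using sum_closed sum_compl by blast
  then obtain z where "ea_sum E a (ea_compl E c) z" "ea_sum E b z (ea_one E)"
    by (rule sum_assoc[OF c])
  then show "ea_le E a (ea_compl E b)"
    using assms by (metis compl le_iff_sum)
next
  assume "ea_le E a (ea_compl E b)"
  then obtain c where c: "ea_sum E a c (ea_compl E b)"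
    using assms le_iff_sum by blast
  obtain x where "ea_sum E b a x"
    by (rule sum_assoc'[OF c sum_compl[OF assms(2)]])
  then show "\<exists>c. ea_sum E a b c"
    using sum_comm by blast
qed

end


section \<open>Intervals of lexicographic products\<close>

lemma (in po_group) po_less_le_trans:
  assumes "x \<in> carrier G" "y \<in> carrier G" "z \<in> carrier G" "po_less G x y" "y \<preceq> z"
  shows "po_less G x z"
  using assms po_antisym[of x y] po_trans[of x y z] unfolding po_less_def by auto

lemma (in po_group) po_less_trans:
  assumes "x \<in> carrier G" "y \<in> carrier G" "z \<in> carrier G" "po_less G x y" "po_less G y z"
  shows "po_less G x z"
  using assms po_less_le_trans[of x y z] unfolding po_less_def by auto

locale lex_pair = H: abelian_po_group H + G: abelian_po_group G
  for H :: "('h, 'm) po_monoid_scheme" and G :: "('g, 'n) po_monoid_scheme" +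
  fixes u
  assumes u_pos: "u \<in> po_pos H" and u_not_one: "u \<noteq> \<one>\<^bsub>H\<^esub>"
begin

lemma lex_simps:
  "carrier (lex_prod H G) = carrier H \<times> carrier G"
  "(h1, g1) \<otimes>\<^bsub>lex_prod H G\<^esub> (h2, g2) = (h1 \<otimes>\<^bsub>H\<^esub> h2, g1 \<otimes>\<^bsub>G\<^esub> g2)"
  "\<one>\<^bsub>lex_prod H G\<^esub> = (\<one>\<^bsub>H\<^esub>, \<one>\<^bsub>G\<^esub>)"
  "(h1, g1) \<preceq>\<^bsub>lex_prod H G\<^esub> (h2, g2) \<longleftrightarrow> po_less H h1 h2 \<or> h1 = h2 \<and> g1 \<preceq>\<^bsub>G\<^esub> g2"
  by (simp_all add: lex_prod_def DirProd_def)

lemma lex_comm_group: "comm_group (lex_prod H G)"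
proof (rule comm_groupI)
  fix x
  assume "x \<in> carrier (lex_prod H G)"
  then show "\<exists>y\<in>carrier (lex_prod H G). y \<otimes>\<^bsub>lex_prod H G\<^esub> x = \<one>\<^bsub>lex_prod H G\<^esub>"
    by (intro bexI[of _ "(inv\<^bsub>H\<^esub> fst x, inv\<^bsub>G\<^esub> snd x)"]) (auto simp: lex_simps)
qed (auto simp: lex_simps H.m_ac G.m_ac)

sublocale L: abelian_po_group "lex_prod H G"
proof (intro abelian_po_group.intro po_group.intro po_group_axioms.intro)
  show "x \<preceq>\<^bsub>lex_prod H G\<^esub> x" if "x \<in> carrier (lex_prod H G)" for x
    using that G.po_refl by (auto simp: lex_simps)
next
  fix x y
  assume "x \<in> carrier (lex_prod H G)" "y \<in> carrier (lex_prod H G)"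
    "x \<preceq>\<^bsub>lex_prod H G\<^esub> y" "y \<preceq>\<^bsub>lex_prod H G\<^esub> x"
  then show "x = y"
    using H.po_antisym[of "fst x" "fst y"] G.po_antisym[of "snd x" "snd y"]
    by (cases x; cases y) (auto simp: lex_simps po_less_def)
next
  fix x y z
  assume "x \<in> carrier (lex_prod H G)" "y \<in> carrier (lex_prod H G)" "z \<in> carrier (lex_prod H G)"
    "x \<preceq>\<^bsub>lex_prod H G\<^esub> y" "y \<preceq>\<^bsub>lex_prod H G\<^esub> z"
  then show "x \<preceq>\<^bsub>lex_prod H G\<^esub> z"
    using H.po_less_trans[of "fst x" "fst y" "fst z"] G.po_trans[of "snd x" "snd y" "snd z"]
    by (cases x; cases y; cases z) (auto simp: lex_simps)
next
  fix g h k f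
  assume "g \<in> carrier (lex_prod H G)" "h \<in> carrier (lex_prod H G)" "k \<in> carrier (lex_prod H G)"
    "f \<in> carrier (lex_prod H G)" "g \<preceq>\<^bsub>lex_prod H G\<^esub> h"
  then show "k \<otimes>\<^bsub>lex_prod H G\<^esub> g \<otimes>\<^bsub>lex_prod H G\<^esub> f \<preceq>\<^bsub>lex_prod H G\<^esub>
      k \<otimes>\<^bsub>lex_prod H G\<^esub> h \<otimes>\<^bsub>lex_prod H G\<^esub> f"
    using H.po_translate[of "fst g" "fst h" "fst k" "fst f"]
      G.po_translate[of "snd g" "snd h" "snd k" "snd f"]
    by (cases g; cases h; cases k; cases f) (auto simp: lex_simps po_less_def)
qed (fact lex_comm_group comm_group.axioms(2)[OF lex_comm_group])+

lemma u_closed: "u \<in> carrier H"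
  using u_pos by (simp add: po_pos_def)

lemma one_u_interval: "\<one>\<^bsub>H\<^esub> \<in> po_interval H u" "u \<in> po_interval H u"
  using u_pos H.po_refl by (auto simp: po_interval_def po_pos_def)

text \<open>Strictly between 0 and \<open>u\<close> the fibre is all of \<open>G\<close>; only the
  lowest and the highest fibre are cut, to the positive and the negative cone. The case distinctions
  below follow this shape.\<close>

lemma Gamma_lex_carrier_iff:
  "(t, g) \<in> carrier (Gamma_lex H u G) \<longleftrightarrow>
    t \<in> po_interval H u \<and> g \<in> carrier G \<and>
    (t = \<one>\<^bsub>H\<^esub> \<longrightarrow> \<one>\<^bsub>G\<^esub> \<preceq>\<^bsub>G\<^esub> g) \<and> (t = u \<longrightarrow> g \<preceq>\<^bsub>G\<^esub> \<one>\<^bsub>G\<^esub>)"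
  using H.po_refl[OF u_closed]
  by (auto simp: Gamma_lex_def Gamma_def po_interval_def lex_simps po_less_def H.po_refl)

lemma Gamma_lex_plus_iff:
  assumes "(s, g) \<in> carrier (Gamma_lex H u G)" "(t, h) \<in> carrier (Gamma_lex H u G)"
  shows "ea_plus (Gamma_lex H u G) (s, g) (t, h) = Some r \<longleftrightarrow>
    r = (s \<otimes>\<^bsub>H\<^esub> t, g \<otimes>\<^bsub>G\<^esub> h) \<and> r \<in> carrier (Gamma_lex H u G)"
proof -
  have carrier: "carrier (Gamma_lex H u G) = po_interval (lex_prod H G) (u, \<one>\<^bsub>G\<^esub>)"
    by (simp add: Gamma_lex_def Gamma_def)
  show ?thesis
    using L.Gamma_plus_iff[of "(u, \<one>\<^bsub>G\<^esub>)" "(s, g)" "(t, h)" r] assms u_closed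
    unfolding carrier by (simp add: lex_simps Gamma_lex_def)
qed

lemma Gamma_lex_le_iff:
  assumes "(s, g) \<in> carrier (Gamma_lex H u G)" "(t, h) \<in> carrier (Gamma_lex H u G)"
  shows "ea_le (Gamma_lex H u G) (s, g) (t, h) \<longleftrightarrow> po_less H s t \<or> s = t \<and> g \<preceq>\<^bsub>G\<^esub> h"
proof -
  have carrier: "carrier (Gamma_lex H u G) = po_interval (lex_prod H G) (u, \<one>\<^bsub>G\<^esub>)"
    by (simp add: Gamma_lex_def Gamma_def)
  show ?thesis
    using L.Gamma_le_iff[of "(u, \<one>\<^bsub>G\<^esub>)" "(s, g)" "(t, h)"] assms u_closed
    unfolding carrier by (simp add: lex_simps Gamma_lex_def)
qed

text \<open>Because 0 and \<open>u\<close> differ, the upper constraint does not reach the lowest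
  fibre; otherwise that fibre would shrink to the identity.\<close>

lemma Gamma_lex_level_one:
  "(\<one>\<^bsub>H\<^esub>, g) \<in> carrier (Gamma_lex H u G) \<longleftrightarrow> g \<in> po_pos G"
  using one_u_interval u_not_one by (auto simp: Gamma_lex_carrier_iff po_pos_def)

lemma Gamma_lex_one: "ea_one (Gamma_lex H u G) = (u, \<one>\<^bsub>G\<^esub>)"
  by (simp add: Gamma_lex_def Gamma_def)

lemma Gamma_lex_plus_closed:
  assumes "x \<in> carrier (Gamma_lex H u G)" "y \<in> carrier (Gamma_lex H u G)"
    and "ea_plus (Gamma_lex H u G) x y = Some z"
  shows "z \<in> carrier (Gamma_lex H u G)"
  using assms Gamma_lex_plus_iff by (cases x, cases y) auto

text \<open>The cone of \<open>G\<close> sits in the interval as the lowest fibre, and refinements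
  of elements of this fibre cannot leave it.\<close>

lemma po_RDP_if_ea_RDP:
  assumes "ea_RDP (Gamma_lex H u G)"
  shows "po_RDP G"
  unfolding po_RDP_def
proof (intro ballI impI)
  let ?\<Gamma> = "Gamma_lex H u G"
  fix a1 a2 b1 b2
  assume pos: "a1 \<in> po_pos G" "a2 \<in> po_pos G" "b1 \<in> po_pos G" "b2 \<in> po_pos G"
    and eq: "a1 \<otimes>\<^bsub>G\<^esub> a2 = b1 \<otimes>\<^bsub>G\<^esub> b2"
  \<comment> \<open>First coordinates are positive in \<open>H\<close>, so if they add up to 0 both
    are 0.\<close>
  have at_one: "fst x = \<one>\<^bsub>H\<^esub>" "fst y = \<one>\<^bsub>H\<^esub>" "snd x \<otimes>\<^bsub>G\<^esub> snd y = z"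
    if xy: "x \<in> carrier ?\<Gamma>" "y \<in> carrier ?\<Gamma>" "ea_plus ?\<Gamma> x y = Some (\<one>\<^bsub>H\<^esub>, z)" for x y z
  proof -
    have fp: "fst x \<in> po_pos H" "fst y \<in> po_pos H"
      using xy(1,2) Gamma_lex_carrier_iff[of "fst x" "snd x"] Gamma_lex_carrier_iff[of "fst y" "snd y"]
      by (auto simp: po_interval_def po_pos_def)
    have s: "fst x \<otimes>\<^bsub>H\<^esub> fst y = \<one>\<^bsub>H\<^esub>" "snd x \<otimes>\<^bsub>G\<^esub> snd y = z"
      using xy Gamma_lex_plus_iff[of "fst x" "snd x" "fst y" "snd y" "(\<one>\<^bsub>H\<^esub>, z)"] by simp_all
    show "fst x = \<one>\<^bsub>H\<^esub>" "fst y = \<one>\<^bsub>H\<^esub>" "snd x \<otimes>\<^bsub>G\<^esub> snd y = z"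
      using H.pos_mult_eq_one[OF fp s(1)] s fp H.pos_closed by auto
  qed
  have in\<Gamma>: "(\<one>\<^bsub>H\<^esub>, g) \<in> carrier ?\<Gamma>" if "g \<in> po_pos G" for g
    using that by (simp add: Gamma_lex_level_one)
  have sums: "ea_plus ?\<Gamma> (\<one>\<^bsub>H\<^esub>, a1) (\<one>\<^bsub>H\<^esub>, a2) = Some (\<one>\<^bsub>H\<^esub>, a1 \<otimes>\<^bsub>G\<^esub> a2)"
    "ea_plus ?\<Gamma> (\<one>\<^bsub>H\<^esub>, b1) (\<one>\<^bsub>H\<^esub>, b2) = Some (\<one>\<^bsub>H\<^esub>, a1 \<otimes>\<^bsub>G\<^esub> a2)"
    using pos eq by (simp_all add: Gamma_lex_plus_iff in\<Gamma> G.pos_mult)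
  obtain c11 c12 c21 c22 where
    c: "c11 \<in> carrier ?\<Gamma>" "c12 \<in> carrier ?\<Gamma>" "c21 \<in> carrier ?\<Gamma>" "c22 \<in> carrier ?\<Gamma>"
    and s: "ea_plus ?\<Gamma> c11 c12 = Some (\<one>\<^bsub>H\<^esub>, a1)" "ea_plus ?\<Gamma> c21 c22 = Some (\<one>\<^bsub>H\<^esub>, a2)"
      "ea_plus ?\<Gamma> c11 c21 = Some (\<one>\<^bsub>H\<^esub>, b1)" "ea_plus ?\<Gamma> c12 c22 = Some (\<one>\<^bsub>H\<^esub>, b2)"
    using assms[unfolded ea_RDP_def, rule_format, OF in\<Gamma> in\<Gamma> in\<Gamma> in\<Gamma> conjI, OF pos sums]
    by blast
  note s1 = at_one[OF c(1,2) s(1)] and s2 = at_one[OF c(3,4) s(2)]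
    and s3 = at_one[OF c(1,3) s(3)] and s4 = at_one[OF c(2,4) s(4)]
  have "snd c11 \<in> po_pos G" "snd c12 \<in> po_pos G" "snd c21 \<in> po_pos G" "snd c22 \<in> po_pos G"
    using c s1(1,2) s2(1,2) by (metis Gamma_lex_level_one prod.collapse)+
  then show "\<exists>c11\<in>po_pos G. \<exists>c12\<in>po_pos G. \<exists>c21\<in>po_pos G. \<exists>c22\<in>po_pos G.
      a1 = c11 \<otimes>\<^bsub>G\<^esub> c12 \<and> a2 = c21 \<otimes>\<^bsub>G\<^esub> c22 \<and> b1 = c11 \<otimes>\<^bsub>G\<^esub> c21 \<and> b2 = c12 \<otimes>\<^bsub>G\<^esub> c22"
    using s1(3) s2(3) s3(3) s4(3) by blast
qed

section \<open>From a lexicographic representation to a strong decomposition\<close>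

lemma iso_strong_decomposition:
  assumes "effect_algebra E" and dir: "po_directed G" and f: "f \<in> ea_iso E (Gamma_lex H u G)"
    and D: "\<And>t. D t = {x \<in> carrier E. fst (f x) = t}"
  shows "strong_decomposition H u E D" and "lex_represents H u E D G"
proof -
  let ?\<Gamma> = "Gamma_lex H u G"
  let ?I = "po_interval H u"
  interpret effect_algebra E by fact
  have bij: "bij_betw f (carrier E) (carrier ?\<Gamma>)"
    using f by (simp add: ea_iso_def)
  have f_one: "f (ea_one E) = (u, \<one>\<^bsub>G\<^esub>)"
    using f by (simp add: ea_iso_def ea_hom_def Gamma_lex_one)
  have fI: "(fst (f x), snd (f x)) \<in> carrier ?\<Gamma>" if "x \<in> carrier E" for x
    using that bij by (auto simp: bij_betw_def)
  then have fst_I: "fst (f x) \<in> ?I" if "x \<in> carrier E" for x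
    using that Gamma_lex_carrier_iff by blast
  have plus: "ea_plus E x y = Some z \<longleftrightarrow>
      fst (f z) = fst (f x) \<otimes>\<^bsub>H\<^esub> fst (f y) \<and> snd (f z) = snd (f x) \<otimes>\<^bsub>G\<^esub> snd (f y)"
    if "x \<in> carrier E" "y \<in> carrier E" "z \<in> carrier E" for x y z
    using ea_iso_plus_iff[OF f that] Gamma_lex_plus_iff[OF fI fI, OF that(1,2), of "f z"] fI[OF that(3)]
    by (auto simp: prod_eq_iff)
  have le: "ea_le E x y \<longleftrightarrow> po_less H (fst (f x)) (fst (f y)) \<or>
      fst (f x) = fst (f y) \<and> snd (f x) \<preceq>\<^bsub>G\<^esub> snd (f y)"
    if "x \<in> carrier E" "y \<in> carrier E" for x y
    using ea_iso_le_iff[OF f that] Gamma_lex_le_iff[OF fI fI, OF that] by simp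
  define k where "k p = inv_into (carrier E) f p" for p
  have k: "k p \<in> carrier E" "f (k p) = p" if "p \<in> carrier ?\<Gamma>" for p
    using that bij by (auto simp: k_def bij_betw_def inv_into_into f_inv_into_f)
  have kf: "k (f x) = x" if "x \<in> carrier E" for x
    using that bij by (simp add: k_def bij_betw_def)
  \<comment> \<open>The origin of level \<open>t\<close> is the preimage of \<open>(t, 0)\<close>;
    the origins add because these pairs do.\<close>
  have c\<Gamma>: "(t, \<one>\<^bsub>G\<^esub>) \<in> carrier ?\<Gamma>" if "t \<in> ?I" for t
    using that G.po_refl by (simp add: Gamma_lex_carrier_iff)
  have c_in: "k (t, \<one>\<^bsub>G\<^esub>) \<in> D t" if "t \<in> ?I" for t
    using k[OF c\<Gamma>[OF that]] by (simp add: D)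
  have compl_in: "ea_compl E x \<in> D (u \<otimes>\<^bsub>H\<^esub> inv\<^bsub>H\<^esub> t)" if "x \<in> D t" for x t
  proof -
    have x: "x \<in> carrier E" "fst (f x) = t" "t \<in> carrier H"
      using that fst_I[of x] by (auto simp: D po_interval_def)
    have y: "ea_compl E x \<in> carrier E" "fst (f (ea_compl E x)) \<in> carrier H"
      using compl_closed[OF x(1)] fst_I[of "ea_compl E x"] by (auto simp: po_interval_def)
    have "u = t \<otimes>\<^bsub>H\<^esub> fst (f (ea_compl E x))"
      using sum_compl[OF x(1)] plus[OF x(1) y(1) ea_one_closed] x
      by (simp add: ea_sum_def f_one)
    then have "fst (f (ea_compl E x)) = u \<otimes>\<^bsub>H\<^esub> inv\<^bsub>H\<^esub> t"
      using x y by (simp add: H.m_comm[of t] H.m_assoc)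
    then show ?thesis
      using y by (simp add: D)
  qed
  have decomposition: "decomposition H u E D"
    unfolding decomposition_def
  proof (intro conjI ballI allI impI)
    show "D t \<noteq> {}" if "t \<in> ?I" for t
      using c_in[OF that] by blast
    show "disjoint_family_on D ?I"
      by (auto simp: disjoint_family_on_def D)
    show "(\<Union>t\<in>?I. D t) = carrier E"
      using fst_I by (auto simp: D)
    show "ea_compl E ` D t = D (u \<otimes>\<^bsub>H\<^esub> inv\<^bsub>H\<^esub> t)" if t: "t \<in> ?I" for t
    \<comment> \<open>Complementation is an involution, and so is \<open>t \<mapsto> u - t\<close>;
      the inclusion \<open>compl_in\<close> at level \<open>u - t\<close> therefore gives the
      reverse inclusion.\<close>
    proof (intro equalityI subsetI)
      fix y
      assume y: "y \<in> D (u \<otimes>\<^bsub>H\<^esub> inv\<^bsub>H\<^esub> t)"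
      have "u \<otimes>\<^bsub>H\<^esub> inv\<^bsub>H\<^esub> (u \<otimes>\<^bsub>H\<^esub> inv\<^bsub>H\<^esub> t) = t"
        using t u_closed by (simp add: po_interval_def H.inv_mult H.m_assoc[symmetric])
      then have "ea_compl E y \<in> D t"
        using compl_in[OF y] by simp
      moreover have "ea_compl E (ea_compl E y) = y"
        using y by (simp add: D compl_compl)
      ultimately show "y \<in> ea_compl E ` D t"
        by (metis imageI)
    qed (use compl_in in blast)
  next
    fix s t x y z
    assume xy: "x \<in> D s" "y \<in> D t" "ea_plus E x y = Some z"
    then have z: "z \<in> carrier E"
      using ea_plus_closed[of x y z] by (simp add: D)
    then have "fst (f z) = s \<otimes>\<^bsub>H\<^esub> t"
      using xy plus[of x y z] by (simp add: D)
    then show "s \<otimes>\<^bsub>H\<^esub> t \<preceq>\<^bsub>H\<^esub> u" "z \<in> D (s \<otimes>\<^bsub>H\<^esub> t)"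
      using fst_I[OF z] z by (auto simp: D po_interval_def)
  qed
  have ordered: "ordered_decomposition H u E D"
    unfolding ordered_decomposition_def using decomposition le by (auto simp: D)
  have lvl: "\<exists>z\<in>D t. snd (f z) = h"
    if "t \<in> ?I" "h \<in> carrier G" "t = \<one>\<^bsub>H\<^esub> \<Longrightarrow> \<one>\<^bsub>G\<^esub> \<preceq>\<^bsub>G\<^esub> h" "t = u \<Longrightarrow> h \<preceq>\<^bsub>G\<^esub> \<one>\<^bsub>G\<^esub>" for t h
    using that k[of "(t, h)"] by (intro bexI[of _ "k (t, h)"]) (auto simp: D Gamma_lex_carrier_iff)
  have directed: "directed_decomposition H u E D"
    unfolding directed_decomposition_def
  proof (intro conjI ballI)
    fix t x y
    assume t: "t \<in> ?I" and xy: "x \<in> D t" "y \<in> D t"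
    let ?g = "snd (f x)" and ?h = "snd (f y)"
    have C: "x \<in> carrier E" "y \<in> carrier E" "fst (f x) = t" "fst (f y) = t"
      using xy by (auto simp: D)
    have g: "?g \<in> carrier G" "t = \<one>\<^bsub>H\<^esub> \<longrightarrow> \<one>\<^bsub>G\<^esub> \<preceq>\<^bsub>G\<^esub> ?g" "t = u \<longrightarrow> ?g \<preceq>\<^bsub>G\<^esub> \<one>\<^bsub>G\<^esub>"
      using fI[OF C(1)] C(3) by (auto simp: Gamma_lex_carrier_iff)
    have h: "?h \<in> carrier G" "t = \<one>\<^bsub>H\<^esub> \<longrightarrow> \<one>\<^bsub>G\<^esub> \<preceq>\<^bsub>G\<^esub> ?h" "t = u \<longrightarrow> ?h \<preceq>\<^bsub>G\<^esub> \<one>\<^bsub>G\<^esub>"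
      using fI[OF C(2)] C(4) by (auto simp: Gamma_lex_carrier_iff)
    obtain b where b: "b \<in> carrier G" "?g \<preceq>\<^bsub>G\<^esub> b" "?h \<preceq>\<^bsub>G\<^esub> b"
      using dir g(1) h(1) unfolding po_directed_def by blast
    obtain l where l: "l \<in> carrier G" "l \<preceq>\<^bsub>G\<^esub> ?g" "l \<preceq>\<^bsub>G\<^esub> ?h"
      by (rule G.directed_down[OF dir g(1) h(1)])
    \<comment> \<open>A bound taken in \<open>G\<close> may leave the two extreme fibres. In the
      highest one 0 is itself an upper bound; dually, in the lowest one 0 is a lower bound.\<close>
    have "\<exists>z\<in>D t. snd (f z) = (if t = u then \<one>\<^bsub>G\<^esub> else b)"
      using t g b u_not_one G.po_trans[of "\<one>\<^bsub>G\<^esub>" ?g b] G.po_refl by (intro lvl) auto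
    then obtain z where "z \<in> D t" "snd (f z) = (if t = u then \<one>\<^bsub>G\<^esub> else b)"
      by blast
    then show "\<exists>z\<in>D t. ea_le E x z \<and> ea_le E y z"
      using C b g h le[of x z] le[of y z] by (intro bexI[of _ z]) (auto simp: D)
    have "\<exists>z\<in>D t. snd (f z) = (if t = \<one>\<^bsub>H\<^esub> then \<one>\<^bsub>G\<^esub> else l)"
      using t g l u_not_one G.po_trans[of l ?g "\<one>\<^bsub>G\<^esub>"] G.po_refl by (intro lvl) auto
    then obtain w where "w \<in> D t" "snd (f w) = (if t = \<one>\<^bsub>H\<^esub> then \<one>\<^bsub>G\<^esub> else l)"
      by blast
    then show "\<exists>z\<in>D t. ea_le E z x \<and> ea_le E z y"
      using C l g h le[of w x] le[of w y] by (intro bexI[of _ w]) (auto simp: D)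
  qed (fact decomposition)
  have c_add: "ea_plus E (k (v, \<one>\<^bsub>G\<^esub>)) (k (t, \<one>\<^bsub>G\<^esub>)) = Some (k (v \<otimes>\<^bsub>H\<^esub> t, \<one>\<^bsub>G\<^esub>))"
    if vt: "v \<in> ?I" "t \<in> ?I" "v \<otimes>\<^bsub>H\<^esub> t \<preceq>\<^bsub>H\<^esub> u" for v t
  proof -
    have "v \<otimes>\<^bsub>H\<^esub> t \<in> ?I"
      using vt H.pos_mult[of v t] by (simp add: po_interval_def po_pos_def)
    then show ?thesis
      using vt k[OF c\<Gamma>] by (simp add: plus)
  qed
  have c_u: "k (u, \<one>\<^bsub>G\<^esub>) = ea_one E"
    using kf[OF ea_one_closed] by (simp add: f_one)
  show "strong_decomposition H u E D"
    unfolding strong_decomposition_def using ordered directed c_in c_add c_u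
    by (intro conjI exI[of _ "\<lambda>t. k (t, \<one>\<^bsub>G\<^esub>)"]) auto
  have "f ` D t = {p \<in> carrier ?\<Gamma>. fst p = t}" for t
  proof -
    have "f ` D t = {p \<in> f ` carrier E. fst p = t}"
      by (auto simp: D)
    then show ?thesis
      using bij by (simp add: bij_betw_def)
  qed
  then show "lex_represents H u E D G"
    unfolding lex_represents_def using f by blast
qed

end


section \<open>The difference group of the bottom level\<close>

text \<open>The origins \<open>c\<close> are a parameter instead of an existential witness, since
  the coordinates are measured from them.\<close>

locale strong_dec = effect_algebra E + H: abelian_po_group H
  for E :: "('a, 'm) effect_alg_scheme" and H :: "('h, 'n) po_monoid_scheme" (structure) +
  fixes u D c
  assumes u_pos: "u \<in> po_pos H" and u_not_one: "u \<noteq> \<one>"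
    and ordered: "ordered_decomposition H u E D"
    and directed: "directed_decomposition H u E D"
    and c_in: "t \<in> po_interval H u \<Longrightarrow> c t \<in> D t"
    and c_plus: "\<lbrakk>v \<in> po_interval H u; t \<in> po_interval H u; v \<otimes> t \<preceq> u\<rbrakk>
      \<Longrightarrow> ea_plus E (c v) (c t) = Some (c (v \<otimes> t))"
    and c_u: "c u = ea_one E"
begin

abbreviation I where "I \<equiv> po_interval H u"

lemma decomp: "decomposition H u E D"
  using ordered by (simp add: ordered_decomposition_def)

lemma I_closed: "t \<in> I \<Longrightarrow> t \<in> carrier H"
  by (simp add: po_interval_def)

lemma one_in: "\<one> \<in> I" and u_in: "u \<in> I"
  using u_pos H.po_refl by (auto simp: po_interval_def po_pos_def)

lemma I_mult: "\<lbrakk>s \<in> I; t \<in> I; s \<otimes> t \<preceq> u\<rbrakk> \<Longrightarrow> s \<otimes> t \<in> I"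
  using H.pos_mult[of s t] by (simp add: po_interval_def po_pos_def)

lemma levels_carrier: "(\<Union>t\<in>I. D t) = carrier E"
  using decomp by (simp add: decomposition_def)

lemma level_closed: "\<lbrakk>t \<in> I; x \<in> D t\<rbrakk> \<Longrightarrow> x \<in> carrier E"
  unfolding levels_carrier[symmetric] by blast

lemma level_exists: "x \<in> carrier E \<Longrightarrow> \<exists>t\<in>I. x \<in> D t"
  unfolding levels_carrier[symmetric] by blast

lemma level_unique: "\<lbrakk>s \<in> I; t \<in> I; x \<in> D s; x \<in> D t\<rbrakk> \<Longrightarrow> s = t"
  using decomp by (auto simp: decomposition_def disjoint_family_on_def)

lemma level_compl:
  assumes "t \<in> I" "x \<in> D t"
  shows "ea_compl E x \<in> D (u \<otimes> inv t)"
proof -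
  have "ea_compl E ` D t = D (u \<otimes> inv t)"
    using decomp assms(1) by (simp add: decomposition_def)
  then show ?thesis
    using assms(2) by blast
qed

lemma level_sum:
  assumes "ea_sum E x y z" "s \<in> I" "t \<in> I" "x \<in> D s" "y \<in> D t"
  shows "s \<otimes> t \<preceq> u" and "z \<in> D (s \<otimes> t)"
  using decomp assms by (simp_all add: decomposition_def ea_sum_def)

lemma level_sum_in: "\<lbrakk>ea_sum E x y z; s \<in> I; t \<in> I; x \<in> D s; y \<in> D t\<rbrakk> \<Longrightarrow> s \<otimes> t \<in> I"
  using I_mult level_sum(1) by blast

lemma level_less_le: "\<lbrakk>s \<in> I; t \<in> I; po_less H s t; x \<in> D s; y \<in> D t\<rbrakk> \<Longrightarrow> ea_le E x y"
  using ordered unfolding ordered_decomposition_def by blast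

lemma level_lower_bound:
  assumes "t \<in> I" "x \<in> D t" "y \<in> D t"
  obtains z where "z \<in> D t" "ea_le E z x" "ea_le E z y"
  using directed assms unfolding directed_decomposition_def by blast

lemma I_compl: "t \<in> I \<Longrightarrow> u \<otimes> inv t \<in> I"
proof -
  assume t: "t \<in> I"
  have u: "u \<in> carrier H"
    by (rule I_closed[OF u_in])
  have "u \<otimes> inv t \<preceq> u \<otimes> inv t \<otimes> t"
    using t u by (intro H.le_mult_pos) (auto simp: po_interval_def po_pos_def)
  then show ?thesis
    using t u H.le_iff_div_pos[of t u] by (simp add: po_interval_def po_pos_def H.m_assoc)
qed

text \<open>From \<open>s + t < u\<close> follows \<open>s < u - t\<close>, the level of the
  complement of \<open>y\<close>. Ordering of the levels puts \<open>x\<close> below that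
  complement, so \<open>x + y\<close> exists.\<close>

lemma sum_exists_if_less:
  assumes "s \<in> I" "t \<in> I" "x \<in> D s" "y \<in> D t" "po_less H (s \<otimes> t) u"
  obtains z where "ea_sum E x y z"
proof -
  have C: "s \<in> carrier H" "t \<in> carrier H" "u \<in> carrier H" "x \<in> carrier E" "y \<in> carrier E"
    using assms I_closed u_in level_closed by auto
  have "s \<preceq> u \<otimes> inv t" "s \<noteq> u \<otimes> inv t"
    using assms(5) C H.le_div_iff[of s u t] by (auto simp: po_less_def H.m_assoc)
  then have "ea_le E x (ea_compl E y)"
    using level_less_le[OF assms(1) I_compl[OF assms(2)] _ assms(3) level_compl[OF assms(2,4)]]
    by (simp add: po_less_def)
  then show ?thesis
    using that sum_defined_iff C by blast
qed

lemma one_less_u: "po_less H \<one> u"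
  using u_pos u_not_one by (simp add: po_less_def po_pos_def)

text \<open>On this level \<open>the\<close> never meets \<open>None\<close>, as
  \<open>M_sum\<close> shows.\<close>

definition M :: "'a monoid" where
  "M = \<lparr>carrier = D \<one>, mult = (\<lambda>a b. the (ea_plus E a b)), one = ea_zero E\<rparr>"

lemma carrier_M: "carrier M = D \<one>" and one_M: "\<one>\<^bsub>M\<^esub> = ea_zero E"
  by (simp_all add: M_def)

lemma M_closed: "a \<in> carrier M \<Longrightarrow> a \<in> carrier E"
  using level_closed one_in carrier_M by blast

lemma M_sum:
  assumes "a \<in> carrier M" "b \<in> carrier M"
  shows "ea_sum E a b (a \<otimes>\<^bsub>M\<^esub> b)"
proof -
  obtain z where "ea_sum E a b z"
    using sum_exists_if_less[of \<one> \<one> a b] assms one_in one_less_u by (auto simp: carrier_M)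
  then show ?thesis
    by (simp add: M_def ea_sum_def)
qed

lemma M_sum_iff:
  "\<lbrakk>a \<in> carrier M; b \<in> carrier M\<rbrakk> \<Longrightarrow> ea_sum E a b z \<longleftrightarrow> z = a \<otimes>\<^bsub>M\<^esub> b"
  using M_sum sum_unique by blast

text \<open>Additivity at level 0 gives \<open>c \<one> + c \<one> = c \<one>\<close>, and
  cancellation leaves 0.\<close>

lemma c_one: "c \<one> = ea_zero E"
proof -
  have c: "c \<one> \<in> carrier E"
    using c_in level_closed one_in by blast
  have "ea_sum E (c \<one>) (c \<one>) (c \<one>)"
    using c_plus[of \<one> \<one>] one_in c u_pos by (simp add: ea_sum_def po_pos_def)
  then show ?thesis
    using sum_cancel sum_zero[OF c] by blast
qed

lemma M_mult_closed: "\<lbrakk>a \<in> carrier M; b \<in> carrier M\<rbrakk> \<Longrightarrow> a \<otimes>\<^bsub>M\<^esub> b \<in> carrier M"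
  using level_sum(2)[OF M_sum one_in one_in] by (simp add: carrier_M)

lemma M_conical: "conical_comm_monoid M"
proof (intro conical_comm_monoid.intro comm_monoidI conical_comm_monoid_axioms.intro)
  show "a \<otimes>\<^bsub>M\<^esub> b \<in> carrier M" if "a \<in> carrier M" "b \<in> carrier M" for a b
    using that by (rule M_mult_closed)
  show "\<one>\<^bsub>M\<^esub> \<in> carrier M"
    using c_in[OF one_in] by (simp add: one_M carrier_M c_one)
  show "a \<otimes>\<^bsub>M\<^esub> b \<otimes>\<^bsub>M\<^esub> d = a \<otimes>\<^bsub>M\<^esub> (b \<otimes>\<^bsub>M\<^esub> d)"
    if abd: "a \<in> carrier M" "b \<in> carrier M" "d \<in> carrier M" for a b d
  proof -
    obtain z where "ea_sum E b d z" "ea_sum E a z (a \<otimes>\<^bsub>M\<^esub> b \<otimes>\<^bsub>M\<^esub> d)"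
      using abd by (elim sum_assoc[OF M_sum M_sum, rotated 4]) (auto intro: M_mult_closed)
    then show ?thesis
      using M_sum_iff abd M_mult_closed by metis
  qed
  show "\<one>\<^bsub>M\<^esub> \<otimes>\<^bsub>M\<^esub> a = a" if "a \<in> carrier M" for a
    using sum_zero_left[OF M_closed[OF that]] by (simp add: M_def ea_sum_def)
  show "a \<otimes>\<^bsub>M\<^esub> b = b \<otimes>\<^bsub>M\<^esub> a" if "a \<in> carrier M" "b \<in> carrier M" for a b
    using that M_sum_iff sum_comm[OF M_sum] by blast
  show "a = b"
    if "a \<in> carrier M" "b \<in> carrier M" "d \<in> carrier M" "a \<otimes>\<^bsub>M\<^esub> d = b \<otimes>\<^bsub>M\<^esub> d" for a b d
    using that sum_cancel sum_comm[OF M_sum] by metis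
  show "a = \<one>\<^bsub>M\<^esub>"
    if "a \<in> carrier M" "b \<in> carrier M" "a \<otimes>\<^bsub>M\<^esub> b = \<one>\<^bsub>M\<^esub>" for a b
    using that sum_eq_zero M_sum[of a b] by (simp add: one_M)
qed

sublocale M: conical_comm_monoid M
  by (rule M_conical)

sublocale L: lex_pair H "diff_group M" u
  using M.diff_group_abelian_po_group H.abelian_po_group_axioms u_pos u_not_one
  by (simp add: lex_pair_def lex_pair_axioms_def)


section \<open>Coordinates of an effect algebra with a strong decomposition\<close>

text \<open>
  \<open>rep t x a b\<close> expresses \<open>x = c t + a - b\<close> without subtraction: \<open>x\<close> and \<open>c t\<close> arise
  from a common lower bound in \<open>D t\<close> by adding \<open>a\<close> and \<open>b\<close>.
\<close>

definition rep :: "'h \<Rightarrow> 'a \<Rightarrow> 'a \<Rightarrow> 'a \<Rightarrow> bool" where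
  "rep t x a b \<longleftrightarrow> a \<in> carrier M \<and> b \<in> carrier M \<and>
    (\<exists>z\<in>D t. ea_sum E z a x \<and> ea_sum E z b (c t))"

text \<open>Levels add, so an increment that does not change the level has level 0.\<close>

lemma diff_in_M:
  assumes "t \<in> I" "z \<in> D t" "x \<in> D t" "ea_sum E z a x"
  shows "a \<in> carrier M"
proof -
  obtain s where s: "s \<in> I" "a \<in> D s"
    using level_exists sum_closed(2)[OF assms(4)] by blast
  note ts = assms(4,1) s(1) assms(2) s(2)
  have "t = t \<otimes> s"
    using level_unique[OF assms(1) level_sum_in[OF ts] assms(3) level_sum(2)[OF ts]] .
  then have "s = \<one>"
    using I_closed[OF assms(1)] I_closed[OF s(1)] H.l_cancel_one'[of t s] by simp
  then show ?thesis
    using s by (simp add: carrier_M)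
qed

lemma sum_M_level:
  assumes "t \<in> I" "z \<in> D t" "a \<in> carrier M" "ea_sum E z a x"
  shows "x \<in> D t"
  using level_sum(2)[OF assms(4,1) one_in assms(2)] assms(1,3) I_closed by (simp add: carrier_M)

lemma common_lower_bound:
  assumes "t \<in> I" "x \<in> D t" "y \<in> D t"
  obtains z a b where "z \<in> D t" "a \<in> carrier M" "b \<in> carrier M" "ea_sum E z a x" "ea_sum E z b y"
proof -
  obtain z where z: "z \<in> D t" "ea_le E z x" "ea_le E z y"
    by (rule level_lower_bound[OF assms])
  obtain a b where ab: "ea_sum E z a x" "ea_sum E z b y"
    using z le_iff_sum[OF level_closed[OF assms(1)]] by blast
  show ?thesis
    by (rule that[OF z(1) diff_in_M[OF assms(1) z(1) assms(2) ab(1)]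
          diff_in_M[OF assms(1) z(1) assms(3) ab(2)] ab])
qed

text \<open>Change of base: replacing the base \<open>z = w + p\<close> by \<open>w\<close> adds
  \<open>p\<close> to every increment.\<close>

lemma shift:
  assumes "ea_sum E w p z" "ea_sum E z a x" "p \<in> carrier M" "a \<in> carrier M"
  shows "ea_sum E w (p \<otimes>\<^bsub>M\<^esub> a) x"
proof -
  obtain q where "ea_sum E p a q" "ea_sum E w q x"
    by (rule sum_assoc[OF assms(1,2)])
  then show ?thesis
    using M_sum_iff[OF assms(3,4)] by simp
qed

lemma rep_level: "\<lbrakk>t \<in> I; rep t x a b\<rbrakk> \<Longrightarrow> x \<in> D t"
  using sum_M_level unfolding rep_def by blast

text \<open>With the same base and the same \<open>b\<close>, comparing \<open>x\<close> and
  \<open>y\<close> reduces to comparing \<open>a\<close> and \<open>a'\<close>. The base is found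
  below \<open>c t\<close> and a common lower bound of \<open>x\<close> and
  \<open>y\<close>.\<close>

lemma rep_common:
  assumes "t \<in> I" "x \<in> D t" "y \<in> D t"
  obtains z a a' b where "rep t x a b" "rep t y a' b" "ea_sum E z a x" "ea_sum E z a' y"
proof -
  obtain w p q where w: "w \<in> D t" "p \<in> carrier M" "q \<in> carrier M" "ea_sum E w p x" "ea_sum E w q y"
    by (rule common_lower_bound[OF assms])
  obtain z r b where z: "z \<in> D t" "r \<in> carrier M" "b \<in> carrier M"
    "ea_sum E z r w" "ea_sum E z b (c t)"
    by (rule common_lower_bound[OF assms(1) w(1) c_in[OF assms(1)]])
  have "ea_sum E z (r \<otimes>\<^bsub>M\<^esub> p) x" "ea_sum E z (r \<otimes>\<^bsub>M\<^esub> q) y"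
    using shift[OF z(4)] w z by auto
  moreover from this have "rep t x (r \<otimes>\<^bsub>M\<^esub> p) b" "rep t y (r \<otimes>\<^bsub>M\<^esub> q) b"
    using w z unfolding rep_def by auto
  ultimately show ?thesis
    using that by blast
qed

lemma rep_exists:
  assumes "t \<in> I" "x \<in> D t"
  obtains a b where "rep t x a b"
  using rep_common[OF assms assms(2)] .

text \<open>Two bases \<open>z = w + p\<close> and \<open>z' = w + p'\<close> are compared over
  \<open>w\<close>: cancelling \<open>w\<close> gives \<open>p + a = p' + a'\<close> and
  \<open>p + b = p' + b'\<close>. Adding these crosswise and cancelling \<open>p + p'\<close> gives
  \<open>a + b' = a' + b\<close>.\<close>

lemma rep_unique:
  assumes t: "t \<in> I" and "rep t x a b" "rep t x a' b'"
  shows "diff_class M a b = diff_class M a' b'"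
proof -
  obtain z where z: "z \<in> D t" "ea_sum E z a x" "ea_sum E z b (c t)"
    and M1: "a \<in> carrier M" "b \<in> carrier M"
    using assms(2) unfolding rep_def by blast
  obtain z' where z': "z' \<in> D t" "ea_sum E z' a' x" "ea_sum E z' b' (c t)"
    and M2: "a' \<in> carrier M" "b' \<in> carrier M"
    using assms(3) unfolding rep_def by blast
  obtain w p p' where w: "w \<in> D t" "p \<in> carrier M" "p' \<in> carrier M"
    "ea_sum E w p z" "ea_sum E w p' z'"
    by (rule common_lower_bound[OF t z(1) z'(1)])
  have 1: "p \<otimes>\<^bsub>M\<^esub> a = p' \<otimes>\<^bsub>M\<^esub> a'"
    using sum_cancel[OF shift[OF w(4) z(2) w(2) M1(1)] shift[OF w(5) z'(2) w(3) M2(1)]] .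
  have 2: "p \<otimes>\<^bsub>M\<^esub> b = p' \<otimes>\<^bsub>M\<^esub> b'"
    using sum_cancel[OF shift[OF w(4) z(3) w(2) M1(2)] shift[OF w(5) z'(3) w(3) M2(2)]] .
  have "(a \<otimes>\<^bsub>M\<^esub> b') \<otimes>\<^bsub>M\<^esub> (p \<otimes>\<^bsub>M\<^esub> p') = (p \<otimes>\<^bsub>M\<^esub> a) \<otimes>\<^bsub>M\<^esub> (p' \<otimes>\<^bsub>M\<^esub> b')"
    using M1 M2 w by (simp add: M.m_ac)
  also have "\<dots> = (p' \<otimes>\<^bsub>M\<^esub> a') \<otimes>\<^bsub>M\<^esub> (p \<otimes>\<^bsub>M\<^esub> b)"
    by (simp add: 1 2)
  also have "\<dots> = (a' \<otimes>\<^bsub>M\<^esub> b) \<otimes>\<^bsub>M\<^esub> (p \<otimes>\<^bsub>M\<^esub> p')"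
    using M1 M2 w by (simp add: M.m_ac)
  finally show ?thesis
    using M1 M2 w by (simp add: M.cancel_iff M.diff_class_eq_iff)
qed

section \<open>The coordinate map and its additivity\<close>

definition coord :: "'a \<Rightarrow> 'h \<times> ('a \<times> 'a) set" where
  "coord x = (THE p. \<exists>a b. fst p \<in> I \<and> rep (fst p) x a b \<and> snd p = diff_class M a b)"

lemma coord_rep:
  assumes "t \<in> I" "rep t x a b"
  shows "coord x = (t, diff_class M a b)"
  unfolding coord_def
proof (rule the_equality)
  fix p
  assume "\<exists>a b. fst p \<in> I \<and> rep (fst p) x a b \<and> snd p = diff_class M a b"
  then obtain a' b' where p: "fst p \<in> I" "rep (fst p) x a' b'" "snd p = diff_class M a' b'"
    by blast
  moreover have "fst p = t"
    using level_unique[OF p(1) assms(1)] rep_level p(1,2) assms by blast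
  ultimately show "p = (t, diff_class M a b)"
    using rep_unique[OF assms] by (simp add: prod_eq_iff)
qed (use assms in auto)

lemma fst_coord: "\<lbrakk>t \<in> I; x \<in> D t\<rbrakk> \<Longrightarrow> fst (coord x) = t"
  by (metis coord_rep fst_conv rep_exists)

text \<open>Over the sum of the two bases, \<open>x + y\<close> has the summed
  \<open>a\<close>-increments and \<open>c r + c t = c (r + t)\<close> has the summed
  \<open>b\<close>-increments; so the differences add.\<close>

lemma coord_sum:
  assumes s: "ea_sum E x y z"
  shows "fst (coord z) = fst (coord x) \<otimes> fst (coord y)"
    and "snd (coord z) = snd (coord x) \<otimes>\<^bsub>diff_group M\<^esub> snd (coord y)"
proof -
  obtain r where r: "r \<in> I" "x \<in> D r"
    using level_exists sum_closed(1)[OF s] by blast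
  obtain t where t: "t \<in> I" "y \<in> D t"
    using level_exists sum_closed(2)[OF s] by blast
  obtain a b where ab: "rep r x a b"
    by (rule rep_exists[OF r])
  obtain a' b' where ab': "rep t y a' b'"
    by (rule rep_exists[OF t])
  obtain v where v: "v \<in> D r" "ea_sum E v a x" "ea_sum E v b (c r)"
    and M1: "a \<in> carrier M" "b \<in> carrier M"
    using ab unfolding rep_def by blast
  obtain w where w: "w \<in> D t" "ea_sum E w a' y" "ea_sum E w b' (c t)"
    and M2: "a' \<in> carrier M" "b' \<in> carrier M"
    using ab' unfolding rep_def by blast
  have rt: "r \<otimes> t \<preceq> u" "r \<otimes> t \<in> I"
    using level_sum(1)[OF s] level_sum_in[OF s] r t by auto
  have cs: "ea_sum E (c r) (c t) (c (r \<otimes> t))"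
    using c_plus[OF r(1) t(1) rt(1)] c_in level_closed r t by (auto simp: ea_sum_def)
  obtain p q where p: "ea_sum E v w p" "ea_sum E a a' q" "ea_sum E p q z"
    by (rule sum_interchange[OF v(2) w(2) s])
  obtain p' q' where p': "ea_sum E v w p'" "ea_sum E b b' q'" "ea_sum E p' q' (c (r \<otimes> t))"
    by (rule sum_interchange[OF v(3) w(3) cs])
  \<comment> \<open>Both interchanges regroup around the same \<open>v + w\<close>, so they yield a
    common base.\<close>
  have "p' = p" "q = a \<otimes>\<^bsub>M\<^esub> a'" "q' = b \<otimes>\<^bsub>M\<^esub> b'"
    using sum_unique[OF p'(1) p(1)] M_sum_iff M1 M2 p(2) p'(2) by auto
  moreover have "p \<in> D (r \<otimes> t)"
    by (rule level_sum(2)[OF p(1) r(1) t(1) v(1) w(1)])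
  ultimately have "rep (r \<otimes> t) z (a \<otimes>\<^bsub>M\<^esub> a') (b \<otimes>\<^bsub>M\<^esub> b')"
    using M1 M2 p p' unfolding rep_def by auto
  then have "coord z = (r \<otimes> t, diff_class M (a \<otimes>\<^bsub>M\<^esub> a') (b \<otimes>\<^bsub>M\<^esub> b'))"
    by (rule coord_rep[OF rt(2)])
  then show "fst (coord z) = fst (coord x) \<otimes> fst (coord y)"
    "snd (coord z) = snd (coord x) \<otimes>\<^bsub>diff_group M\<^esub> snd (coord y)"
    using coord_rep[OF r(1) ab] coord_rep[OF t(1) ab'] M1 M2
    by (simp_all add: M.diff_group_simps M.diff_mult_class)
qed

lemma coord_in_level_one: "x \<in> carrier M \<Longrightarrow> coord x = (\<one>, diff_class M x \<one>\<^bsub>M\<^esub>)"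
proof (rule coord_rep[OF one_in])
  assume x: "x \<in> carrier M"
  have "ea_zero E \<in> D \<one>"
    using M.one_closed by (simp add: carrier_M one_M)
  then show "rep \<one> x x \<one>\<^bsub>M\<^esub>"
    using x sum_zero_left[OF M_closed[OF x]] sum_zero_left[OF ea_zero_closed]
    unfolding rep_def c_one one_M[symmetric] by auto
qed

text \<open>The complement of \<open>x\<close> serves as its own base, since adding \<open>x\<close>
  to it gives \<open>1 = c u\<close>. The highest level is thus the mirror image of the
  lowest.\<close>

lemma coord_compl_M: "x \<in> carrier M \<Longrightarrow> coord (ea_compl E x) = (u, diff_class M \<one>\<^bsub>M\<^esub> x)"
proof (rule coord_rep[OF u_in])
  assume x: "x \<in> carrier M"
  then have xE: "x \<in> carrier E"
    by (rule M_closed)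
  have "ea_compl E x \<in> D u"
    using level_compl[OF one_in, of x] x I_closed[OF u_in] by (simp add: carrier_M)
  then show "rep u (ea_compl E x) \<one>\<^bsub>M\<^esub> x"
    using x sum_zero[OF compl_closed[OF xE]] sum_comm[OF sum_compl[OF xE]]
    unfolding rep_def c_u one_M[symmetric] by auto
qed

lemma coord_one: "coord (ea_one E) = (u, \<one>\<^bsub>diff_group M\<^esub>)"
proof -
  have "ea_compl E (ea_zero E) = ea_one E"
    using compl[OF ea_zero_closed, of "ea_one E"] sum_zero_left[OF ea_one_closed] by simp
  then show ?thesis
    using coord_compl_M[OF M.one_closed] by (simp add: M.diff_group_simps one_M)
qed

lemma snd_coord_closed:
  assumes "x \<in> carrier E"
  shows "snd (coord x) \<in> carrier (diff_group M)"
proof -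
  obtain t where t: "t \<in> I" "x \<in> D t"
    using level_exists[OF assms] by blast
  obtain a b where ab: "rep t x a b"
    by (rule rep_exists[OF t])
  then show ?thesis
    using coord_rep[OF t(1) ab] M.diff_groupI by (simp add: rep_def)
qed

lemma coord_level:
  assumes "x \<in> carrier E"
  shows "fst (coord x) \<in> I" "x \<in> D (fst (coord x))"
  using level_exists[OF assms] fst_coord by auto

section \<open>Order reflection and bijectivity of the coordinates\<close>

text \<open>Over a common base, \<open>a - b \<le> a' - b\<close> means \<open>a' = a + m\<close>
  for some \<open>m\<close> in \<open>M\<close>; then
  \<open>y = z + a' = (z + a) + m = x + m\<close>. Both injectivity and the critical case of
  definedness of sums rest on this.\<close>

lemma coord_le_imp_le:
  assumes x: "x \<in> carrier E" and y: "y \<in> carrier E" and eq: "fst (coord x) = fst (coord y)"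
    and le: "po_le (diff_group M) (snd (coord x)) (snd (coord y))"
  shows "ea_le E x y"
proof -
  let ?t = "fst (coord x)"
  have t: "?t \<in> I" "x \<in> D ?t" "y \<in> D ?t"
    using coord_level[OF x] coord_level[OF y] eq by simp_all
  obtain z a a' b where rep: "rep ?t x a b" "rep ?t y a' b" and s: "ea_sum E z a x" "ea_sum E z a' y"
    by (rule rep_common[OF t])
  have ab: "a \<in> carrier M" "a' \<in> carrier M" "b \<in> carrier M"
    using rep by (auto simp: rep_def)
  have "po_le (diff_group M) (diff_class M a b) (diff_class M a' b)"
    using le arg_cong[OF coord_rep[OF t(1) rep(1)], of snd]
      arg_cong[OF coord_rep[OF t(1) rep(2)], of snd] by simp
  then obtain m where m: "m \<in> carrier M" "a' \<otimes>\<^bsub>M\<^esub> b = a \<otimes>\<^bsub>M\<^esub> b \<otimes>\<^bsub>M\<^esub> m"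
    using M.diff_group_le_iff ab by auto
  then have "a' \<otimes>\<^bsub>M\<^esub> b = (a \<otimes>\<^bsub>M\<^esub> m) \<otimes>\<^bsub>M\<^esub> b"
    using ab by (simp add: M.m_ac)
  then have "a' = a \<otimes>\<^bsub>M\<^esub> m"
    using ab m M.cancel by blast
  then obtain v where "ea_sum E z a v" "ea_sum E v m y"
    using sum_assoc'[OF M_sum[OF ab(1) m(1)]] s(2) by blast
  then show ?thesis
    using sum_unique[OF s(1)] le_iff_sum[OF x] by blast
qed

lemma le_antisym:
  assumes "x \<in> carrier E" "y \<in> carrier E" "ea_le E x y" "ea_le E y x"
  shows "x = y"
proof -
  obtain a b where ab: "ea_sum E x a y" "ea_sum E y b x"
    using assms le_iff_sum by blast
  then obtain z where "ea_sum E a b z" "ea_sum E x z x"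
    using sum_assoc by blast
  then have "ea_sum E a b (ea_zero E)"
    using sum_cancel sum_zero[OF assms(1)] by blast
  then show ?thesis
    using sum_eq_zero ab(1) sum_zero[OF assms(1)] sum_unique by metis
qed

lemma coord_inj: "inj_on coord (carrier E)"
proof (rule inj_onI)
  fix x y
  assume xy: "x \<in> carrier E" "y \<in> carrier E" "coord x = coord y"
  then show "x = y"
    using coord_le_imp_le[of x y] coord_le_imp_le[of y x] L.G.po_refl[OF snd_coord_closed]
    by (intro le_antisym) auto
qed

lemma coord_in_Gamma:
  assumes x: "x \<in> carrier E"
  shows "coord x \<in> carrier (Gamma_lex H u (diff_group M))"
proof -
  note t = coord_level[OF x]
  have "\<one>\<^bsub>diff_group M\<^esub> \<preceq>\<^bsub>diff_group M\<^esub> snd (coord x)" if "fst (coord x) = \<one>"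
  proof -
    have "x \<in> carrier M"
      using t that by (simp add: carrier_M)
    then show ?thesis
      by (simp add: coord_in_level_one M.diff_group_simps(2) M.diff_group_le_iff)
  qed
  moreover have "snd (coord x) \<preceq>\<^bsub>diff_group M\<^esub> \<one>\<^bsub>diff_group M\<^esub>" if "fst (coord x) = u"
  proof -
    have "ea_compl E x \<in> carrier M"
      using t that level_compl[of u x] I_closed[OF u_in] by (simp add: carrier_M)
    then show ?thesis
      using coord_compl_M[of "ea_compl E x"] compl_compl[OF x]
      by (simp add: M.diff_group_simps(2) M.diff_group_le_iff)
  qed
  ultimately show ?thesis
    using t snd_coord_closed[OF x] L.Gamma_lex_carrier_iff[of "fst (coord x)" "snd (coord x)"] by simp
qed

lemma coord_onto:
  assumes "(t, g) \<in> carrier (Gamma_lex H u (diff_group M))"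
  shows "\<exists>x\<in>carrier E. coord x = (t, g)"
proof -
  have t: "t \<in> I" and g: "g \<in> carrier (diff_group M)"
    and pos: "t = \<one> \<Longrightarrow> \<one>\<^bsub>diff_group M\<^esub> \<preceq>\<^bsub>diff_group M\<^esub> g"
    and neg: "t = u \<Longrightarrow> g \<preceq>\<^bsub>diff_group M\<^esub> \<one>\<^bsub>diff_group M\<^esub>"
    using assms L.Gamma_lex_carrier_iff by auto
  obtain a b where ab: "a \<in> carrier M" "b \<in> carrier M" and gab: "g = diff_class M a b"
    by (rule M.diff_groupE[OF g])
  consider "t = \<one>" | "t = u" | "t \<noteq> \<one>" "t \<noteq> u"
    by blast
  then show ?thesis
  proof cases
    \<comment> \<open>Here \<open>a - b\<close> is positive, so it equals \<open>m - 0\<close> for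
      some \<open>m\<close> in \<open>M\<close>, and \<open>m\<close> itself is the
      preimage.\<close>
    case 1
    then obtain m where m: "m \<in> carrier M" "a = b \<otimes>\<^bsub>M\<^esub> m"
      using pos ab M.diff_group_le_iff[of "\<one>\<^bsub>M\<^esub>" "\<one>\<^bsub>M\<^esub>" a b] by (auto simp: gab M.diff_group_simps(2))
    then have "coord m = (t, g)"
      using 1 ab by (simp add: coord_in_level_one gab M.diff_class_eq_iff M.m_comm)
    then show ?thesis
      using M_closed[OF m(1)] by blast
  next
    \<comment> \<open>Here \<open>a - b = 0 - m\<close>, which is the second coordinate of the
      complement of \<open>m\<close>.\<close>
    case 2
    then obtain m where m: "m \<in> carrier M" "b = a \<otimes>\<^bsub>M\<^esub> m"
      using neg ab M.diff_group_le_iff[of a b "\<one>\<^bsub>M\<^esub>" "\<one>\<^bsub>M\<^esub>"] by (auto simp: gab M.diff_group_simps(2))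
    then have "coord (ea_compl E m) = (t, g)"
      using 2 ab by (simp add: coord_compl_M gab M.diff_class_eq_iff)
    then show ?thesis
      using compl_closed[OF M_closed[OF m(1)]] by blast
  next
    case 3
    have "po_less H \<one> t" "po_less H (t \<otimes> \<one>) u"
      using 3 t by (auto simp: po_less_def po_interval_def)
    then have "ea_le E b (c t)"
      using level_less_le[OF one_in t] ab c_in[OF t] by (simp add: carrier_M)
    then obtain z where z: "ea_sum E z b (c t)"
      using le_iff_sum[OF M_closed[OF ab(2)]] sum_comm by blast
    \<comment> \<open>The base \<open>z\<close> comes without a level, but adding an element of
      \<open>M\<close> preserves levels and \<open>c t\<close> lies in \<open>D t\<close>.\<close>
    obtain s where s: "s \<in> I" "z \<in> D s"
      using level_exists sum_closed(1)[OF z] by blast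
    have "c t \<in> D s"
      using sum_M_level[OF s ab(2) z] .
    then have zt: "z \<in> D t"
      using level_unique[OF s(1) t] c_in[OF t] s by blast
    obtain x where x: "ea_sum E z a x"
      using sum_exists_if_less[OF t one_in zt _ \<open>po_less H (t \<otimes> \<one>) u\<close>] ab(1) by (auto simp: carrier_M)
    have "rep t x a b"
      using zt x z ab unfolding rep_def by blast
    then have "coord x = (t, g)"
      using coord_rep[OF t] gab by blast
    then show ?thesis
      using sum_closed(3)[OF x] by blast
  qed
qed

text \<open>This makes the inverse of \<open>coord\<close> a homomorphism: a sum of coordinates that
  stays in the interval comes from a sum in \<open>E\<close>.\<close>

lemma coord_sum_defined:
  assumes x: "x \<in> carrier E" and y: "y \<in> carrier E"
    and p: "ea_plus (Gamma_lex H u (diff_group M)) (coord x) (coord y) = Some r"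
  obtains z where "ea_sum E x y z"
proof -
  obtain s X where cx: "coord x = (s, X)"
    by (cases "coord x")
  obtain t Y where cy: "coord y = (t, Y)"
    by (cases "coord y")
  have st: "s \<in> I" "t \<in> I" "x \<in> D s" "y \<in> D t"
    using coord_level[OF x] coord_level[OF y] by (auto simp: cx cy)
  have C: "X \<in> carrier (diff_group M)" "Y \<in> carrier (diff_group M)" "s \<in> carrier H" "t \<in> carrier H"
    using snd_coord_closed[OF x] snd_coord_closed[OF y] st I_closed by (auto simp: cx cy)
  have "(s \<otimes> t, X \<otimes>\<^bsub>diff_group M\<^esub> Y) \<in> carrier (Gamma_lex H u (diff_group M))"
    using p L.Gamma_lex_plus_iff coord_in_Gamma[OF x] coord_in_Gamma[OF y] by (auto simp: cx cy)
  then have le: "s \<otimes> t \<preceq> u"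
    and neg: "s \<otimes> t = u \<Longrightarrow> X \<otimes>\<^bsub>diff_group M\<^esub> Y \<preceq>\<^bsub>diff_group M\<^esub> \<one>\<^bsub>diff_group M\<^esub>"
    by (auto simp: L.Gamma_lex_carrier_iff po_interval_def)
  show ?thesis
  proof (cases "s \<otimes> t = u")
    case False
    then show ?thesis
      using sum_exists_if_less[OF st] that le by (auto simp: po_less_def)
  next
    case True
    \<comment> \<open>Additivity applied to \<open>y\<close> and its complement gives that
      complement the coordinates \<open>(u - t, - Y)\<close>. Since \<open>s = u - t\<close> and
      \<open>X + Y \<le> 0\<close>, order reflection puts \<open>x\<close> below it.\<close>
    let ?y = "ea_compl E y"
    have y': "?y \<in> carrier E"
      by (rule compl_closed[OF y])
    have "fst (coord ?y) \<in> carrier H"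
      using coord_level(1)[OF y'] I_closed by blast
    moreover have "u = t \<otimes> fst (coord ?y)"
      and Y': "\<one>\<^bsub>diff_group M\<^esub> = Y \<otimes>\<^bsub>diff_group M\<^esub> snd (coord ?y)"
      using coord_sum[OF sum_compl[OF y]] by (auto simp: coord_one cy)
    ultimately have 1: "fst (coord x) = fst (coord ?y)"
      using True C H.m_comm[of s t] H.Units_l_cancel[of t s "fst (coord ?y)"] by (simp add: cx)
    have "snd (coord ?y) = inv\<^bsub>diff_group M\<^esub> Y"
      using Y' C snd_coord_closed[OF y'] L.G.inv_equality[of "snd (coord ?y)" Y] by (simp add: L.G.m_comm)
    then have "X \<preceq>\<^bsub>diff_group M\<^esub> snd (coord ?y)"
      using neg[OF True] C L.G.le_div_iff[of X "\<one>\<^bsub>diff_group M\<^esub>" Y] by simp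
    then have "ea_le E x ?y"
      using coord_le_imp_le[OF x y' 1] by (simp add: cx)
    then show ?thesis
      using that sum_defined_iff[OF x y] by blast
  qed
qed

lemma coord_iso: "coord \<in> ea_iso E (Gamma_lex H u (diff_group M))"
proof -
  let ?\<Gamma> = "Gamma_lex H u (diff_group M)"
  have onto: "coord ` carrier E = carrier ?\<Gamma>"
    using coord_in_Gamma coord_onto by (auto simp: image_iff) (metis)
  have bij: "bij_betw coord (carrier E) (carrier ?\<Gamma>)"
    using onto coord_inj by (simp add: bij_betw_def)
  have plus: "ea_plus ?\<Gamma> (coord x) (coord y) = Some (coord z)" if s: "ea_sum E x y z" for x y z
    using coord_in_Gamma sum_closed[OF s] coord_sum[OF s]
      L.Gamma_lex_plus_iff[of "fst (coord x)" "snd (coord x)" "fst (coord y)" "snd (coord y)" "coord z"]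
    by (simp add: prod_eq_iff)
  have hom: "coord \<in> ea_hom E ?\<Gamma>"
    using coord_in_Gamma coord_one plus by (simp add: ea_hom_def L.Gamma_lex_one ea_sum_def)
  let ?k = "inv_into (carrier E) coord"
  have k: "?k p \<in> carrier E" "coord (?k p) = p" if "p \<in> carrier ?\<Gamma>" for p
    using that onto by (metis inv_into_into, metis f_inv_into_f)
  have kc: "?k (coord x) = x" if "x \<in> carrier E" for x
    using coord_inj that by simp
  have k_plus: "ea_plus E (?k p) (?k q) = Some (?k r)"
    if pq: "p \<in> carrier ?\<Gamma>" "q \<in> carrier ?\<Gamma>" "ea_plus ?\<Gamma> p q = Some r" for p q r
  proof -
    obtain z where z: "ea_sum E (?k p) (?k q) z"
      using coord_sum_defined[of "?k p" "?k q" r] k pq by auto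
    then have "coord z = r"
      using plus[OF z] k pq by simp
    then show ?thesis
      using z kc[OF sum_closed(3)[OF z]] by (auto simp: ea_sum_def)
  qed
  have "?k \<in> ea_hom ?\<Gamma> E"
    using k k_plus kc[OF ea_one_closed] by (simp add: ea_hom_def L.Gamma_lex_one coord_one)
  then show ?thesis
    using bij hom by (simp add: ea_iso_def)
qed

lemma diff_group_represents: "lex_represents H u E D (diff_group M)"
proof -
  have "coord ` D t = {p \<in> carrier (Gamma_lex H u (diff_group M)). fst p = t}" if "t \<in> I" for t
  proof -
    have D: "D t = {x \<in> carrier E. fst (coord x) = t}"
      using fst_coord[OF that] level_closed[OF that] coord_level(2) by auto
    have "coord ` D t = {p \<in> coord ` carrier E. fst p = t}"
      unfolding D by blast
    moreover have "coord ` carrier E = carrier (Gamma_lex H u (diff_group M))"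
      using coord_iso by (simp add: ea_iso_def bij_betw_def)
    ultimately show ?thesis
      by simp
  qed
  then show ?thesis
    unfolding lex_represents_def using coord_iso by blast
qed

section \<open>Uniqueness of the representing group\<close>

text \<open>The isomorphism carries the lowest level onto the lowest fibre, a copy of the cone of
  \<open>G\<close>. As \<open>M\<close> depends only on \<open>E\<close> and the decomposition, all
  representing groups share one cone up to isomorphism.\<close>

lemma represents_cone:
  assumes "abelian_po_group G" "lex_represents H u E D G"
  obtains \<psi> where "bij_betw \<psi> (carrier M) (po_pos G)"
    "\<And>a b. \<lbrakk>a \<in> carrier M; b \<in> carrier M\<rbrakk> \<Longrightarrow> \<psi> (a \<otimes>\<^bsub>M\<^esub> b) = \<psi> a \<otimes>\<^bsub>G\<^esub> \<psi> b"
proof -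
  interpret LG: lex_pair H G u
    using assms H.abelian_po_group_axioms u_pos u_not_one by (simp add: lex_pair_def lex_pair_axioms_def)
  obtain f where f: "f \<in> ea_iso E (Gamma_lex H u G)"
    and img: "f ` D \<one> = {p \<in> carrier (Gamma_lex H u G). fst p = \<one>}"
    using assms(2) one_in unfolding lex_represents_def by blast
  have img': "f ` carrier M = Pair \<one> ` po_pos G"
    unfolding carrier_M img using LG.Gamma_lex_level_one by (auto simp: image_iff)
  have pair: "f a = (\<one>, snd (f a))" "(\<one>, snd (f a)) \<in> carrier (Gamma_lex H u G)"
    if "a \<in> carrier M" for a
  proof -
    have "f a \<in> {p \<in> carrier (Gamma_lex H u G). fst p = \<one>}"
      using that unfolding img[symmetric] carrier_M by (rule imageI)
    then show "f a = (\<one>, snd (f a))" "(\<one>, snd (f a)) \<in> carrier (Gamma_lex H u G)"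
      by (cases "f a"; simp)+
  qed
  have "inj_on f (carrier M)"
    using f M_closed by (auto simp: ea_iso_def bij_betw_def intro: inj_on_subset)
  then have "inj_on (\<lambda>a. snd (f a)) (carrier M)"
    using pair(1) by (metis (no_types, lifting) inj_on_def)
  moreover have "(\<lambda>a. snd (f a)) ` carrier M = po_pos G"
  proof -
    have "(\<lambda>a. snd (f a)) ` carrier M = snd ` f ` carrier M"
      by (simp add: image_image)
    then show ?thesis
      by (simp add: img' image_image)
  qed
  moreover have "snd (f (a \<otimes>\<^bsub>M\<^esub> b)) = snd (f a) \<otimes>\<^bsub>G\<^esub> snd (f b)"
    if ab: "a \<in> carrier M" "b \<in> carrier M" for a b
  proof -
    have "ea_plus E a b = Some (a \<otimes>\<^bsub>M\<^esub> b)"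
      using M_sum[OF ab] by (simp add: ea_sum_def)
    then have "ea_plus (Gamma_lex H u G) (f a) (f b) = Some (f (a \<otimes>\<^bsub>M\<^esub> b))"
      using f ab M_closed by (simp add: ea_iso_def ea_hom_def)
    then show ?thesis
      using LG.Gamma_lex_plus_iff[OF pair(2)[OF ab(1)] pair(2)[OF ab(2)], of "f (a \<otimes>\<^bsub>M\<^esub> b)"] pair(1) ab
      by (metis snd_conv)
  qed
  ultimately show ?thesis
    using that[of "\<lambda>a. snd (f a)"] by (simp add: bij_betw_def)
qed

lemma represents_unique:
  assumes "abelian_po_group G1" "po_directed G1" "lex_represents H u E D G1"
    and "abelian_po_group G2" "po_directed G2" "lex_represents H u E D G2"
  shows "po_isomorphic G1 G2"
proof -
  obtain \<psi>1 where b1: "bij_betw \<psi>1 (carrier M) (po_pos G1)"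
    and a1: "\<And>a b. \<lbrakk>a \<in> carrier M; b \<in> carrier M\<rbrakk> \<Longrightarrow> \<psi>1 (a \<otimes>\<^bsub>M\<^esub> b) = \<psi>1 a \<otimes>\<^bsub>G1\<^esub> \<psi>1 b"
    using represents_cone[OF assms(1,3)] by metis
  obtain \<psi>2 where b2: "bij_betw \<psi>2 (carrier M) (po_pos G2)"
    and a2: "\<And>a b. \<lbrakk>a \<in> carrier M; b \<in> carrier M\<rbrakk> \<Longrightarrow> \<psi>2 (a \<otimes>\<^bsub>M\<^esub> b) = \<psi>2 a \<otimes>\<^bsub>G2\<^esub> \<psi>2 b"
    using represents_cone[OF assms(4,6)] by metis
  let ?k = "inv_into (carrier M) \<psi>1"
  have k: "?k x \<in> carrier M" "\<psi>1 (?k x) = x" if "x \<in> po_pos G1" for x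
    using that bij_betw_imp_surj_on[OF b1] by (metis inv_into_into, metis f_inv_into_f)
  have "?k (x \<otimes>\<^bsub>G1\<^esub> y) = ?k x \<otimes>\<^bsub>M\<^esub> ?k y" if "x \<in> po_pos G1" "y \<in> po_pos G1" for x y
    using a1[of "?k x" "?k y"] k that bij_betw_inv_into_left[OF b1, of "?k x \<otimes>\<^bsub>M\<^esub> ?k y"] by simp
  then have "(\<psi>2 \<circ> ?k) (x \<otimes>\<^bsub>G1\<^esub> y) = (\<psi>2 \<circ> ?k) x \<otimes>\<^bsub>G2\<^esub> (\<psi>2 \<circ> ?k) y"
    if "x \<in> po_pos G1" "y \<in> po_pos G1" for x y
    using that a2 k by simp
  then show ?thesis
    using po_isomorphic_if_cones[OF assms(1,2,4,5) bij_betw_trans[OF bij_betw_inv_into[OF b1] b2]]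
    by blast
qed

end

section \<open>Combining both directions\<close>

lemma strong_decE:
  assumes "effect_algebra E" "abelian_po_group H" "u \<in> po_pos H" "u \<noteq> \<one>\<^bsub>H\<^esub>"
    and "strong_decomposition H u E D"
  obtains c where "strong_dec E H u D c"
proof -
  obtain c where "\<forall>t\<in>po_interval H u. c t \<in> D t"
    "\<forall>v\<in>po_interval H u. \<forall>t\<in>po_interval H u. v \<otimes>\<^bsub>H\<^esub> t \<preceq>\<^bsub>H\<^esub> u \<longrightarrow>
        ea_plus E (c v) (c t) = Some (c (v \<otimes>\<^bsub>H\<^esub> t))" "c u = ea_one E"
    using assms(5) unfolding strong_decomposition_def by blast
  then have "strong_dec E H u D c"
    using assms unfolding strong_decomposition_def
    by (intro strong_dec.intro strong_dec_axioms.intro) auto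
  then show ?thesis
    by (rule that)
qed

text \<open>The carrier type \<open>('a \<times> 'a) set\<close> in the existence claims is that of
  classes of pairs from the lowest level, where the difference group lives. Claims about a given
  group are made for the arbitrary types \<open>'g\<close> and \<open>'k\<close>.\<close>

theorem theorem5p1:
  fixes E :: "'a effect_alg" and H :: "'h po_monoid" and u :: 'h
  assumes "effect_algebra E" and "ea_RDP E"
    and "abelian_po_group H" and "strong_unit H u" and "po_RDP H"
    and "carrier H \<noteq> {\<one>\<^bsub>H\<^esub>}"
  shows
    "(strong_perfect H u E \<longleftrightarrow>
       (\<exists>G :: ('a \<times> 'a) set po_monoid. abelian_po_group G \<and> po_directed G \<and>
          ea_isomorphic E (Gamma_lex H u G))) \<and>
     (\<forall>G :: 'g po_monoid. abelian_po_group G \<and> po_directed G \<and>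
          ea_isomorphic E (Gamma_lex H u G) \<longrightarrow>
        strong_perfect H u E \<and> po_RDP G \<and>
        (\<exists>D. strong_decomposition H u E D \<and> lex_represents H u E D G)) \<and>
     (\<forall>D. strong_decomposition H u E D \<longrightarrow>
        (\<exists>G :: ('a \<times> 'a) set po_monoid. abelian_po_group G \<and> po_directed G \<and>
           lex_represents H u E D G) \<and>
        (\<forall>(G1 :: 'g po_monoid) (G2 :: 'k po_monoid).
           abelian_po_group G1 \<and> po_directed G1 \<and> lex_represents H u E D G1 \<and>
           abelian_po_group G2 \<and> po_directed G2 \<and> lex_represents H u E D G2 \<longrightarrow>
           po_isomorphic G1 G2))"
proof -
  interpret H: abelian_po_group H by fact
  have u: "u \<in> po_pos H" "u \<noteq> \<one>\<^bsub>H\<^esub>"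
    using assms(4,6) H.strong_unit_nontrivial by (auto simp: strong_unit_def)
  \<comment> \<open>The type \<open>'x\<close> does not occur in the statement, so
    \<open>pair\<close> and \<open>converse\<close> apply to groups over \<open>'g\<close> and over
    classes of pairs alike.\<close>
  have pair: "lex_pair H G u" if "abelian_po_group G" for G :: "'x po_monoid"
    using that u assms(3) by (simp add: lex_pair_def lex_pair_axioms_def)
  have converse: "\<exists>D. strong_decomposition H u E D \<and> lex_represents H u E D G"
    if G: "abelian_po_group G" "po_directed G" "ea_isomorphic E (Gamma_lex H u G)"
    for G :: "'x po_monoid"
  proof -
    obtain f where "f \<in> ea_iso E (Gamma_lex H u G)"
      using G(3) by (auto simp: ea_isomorphic_def)
    then show ?thesis
      using lex_pair.iso_strong_decomposition[OF pair[OF G(1)] assms(1) G(2),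
          where D = "\<lambda>t. {x \<in> carrier E. fst (f x) = t}"] by blast
  qed
  have RDP: "po_RDP G" if G: "abelian_po_group G" "ea_isomorphic E (Gamma_lex H u G)"
    for G :: "'g po_monoid"
  proof -
    interpret lex_pair H G u
      by (rule pair[OF G(1)])
    obtain f where "f \<in> ea_iso E (Gamma_lex H u G)"
      using G(2) by (auto simp: ea_isomorphic_def)
    then have "ea_RDP (Gamma_lex H u G)"
      using ea_iso_RDP assms(1,2) Gamma_lex_plus_closed by blast
    then show ?thesis
      by (rule po_RDP_if_ea_RDP)
  qed
  have exists: "\<exists>G :: ('a \<times> 'a) set po_monoid. abelian_po_group G \<and> po_directed G \<and>
      lex_represents H u E D G" if D: "strong_decomposition H u E D" for D
  proof -
    obtain c where "strong_dec E H u D c"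
      by (rule strong_decE[OF assms(1,3) u D])
    then interpret strong_dec E H u D c .
    show ?thesis
      using M.diff_group_abelian_po_group M.diff_group_directed diff_group_represents by blast
  qed
  have unique: "po_isomorphic G1 G2"
    if D: "strong_decomposition H u E D"
      and "abelian_po_group G1 \<and> po_directed G1 \<and> lex_represents H u E D G1 \<and>
        abelian_po_group G2 \<and> po_directed G2 \<and> lex_represents H u E D G2"
    for D and G1 :: "'g po_monoid" and G2 :: "'k po_monoid"
  proof -
    obtain c where "strong_dec E H u D c"
      by (rule strong_decE[OF assms(1,3) u D])
    then interpret strong_dec E H u D c .
    show ?thesis
      using that(2) by (intro represents_unique) simp_all
  qed
  have iso: "ea_isomorphic E (Gamma_lex H u G)" if "lex_represents H u E D G"
    for D and G :: "('a \<times> 'a) set po_monoid"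
    using that by (auto simp: lex_represents_def ea_isomorphic_def)
  have perfect: "strong_perfect H u E \<longleftrightarrow> (\<exists>D. strong_decomposition H u E D)"
    using assms by (simp add: strong_perfect_def)
  show ?thesis
    unfolding perfect
  proof (intro conjI allI impI)
    show "(\<exists>D. strong_decomposition H u E D) \<longleftrightarrow>
      (\<exists>G :: ('a \<times> 'a) set po_monoid. abelian_po_group G \<and> po_directed G \<and>
        ea_isomorphic E (Gamma_lex H u G))"
    proof
      assume "\<exists>D. strong_decomposition H u E D"
      then obtain D where "strong_decomposition H u E D" ..
      from exists[OF this] show "\<exists>G :: ('a \<times> 'a) set po_monoid. abelian_po_group G \<and>
          po_directed G \<and> ea_isomorphic E (Gamma_lex H u G)"
        using iso by blast
    qed (use converse in blast)
  next
    fix G :: "'g po_monoid"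
    assume G: "abelian_po_group G \<and> po_directed G \<and> ea_isomorphic E (Gamma_lex H u G)"
    then show "\<exists>D. strong_decomposition H u E D \<and> lex_represents H u E D G"
      by (intro converse) simp_all
    then show "\<exists>D. strong_decomposition H u E D"
      by blast
    show "po_RDP G"
      using G by (intro RDP) simp_all
  qed (rule exists unique, assumption+)+
qed

end
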